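(* Let $d\ge 2$ and let $\Xi$ be an $\mathbb{R}^{d-1}$-stationary and ergodic random closed set in $\mathbb{R}^d$. Suppose there exists at most one $r_0>0$ with $$2\,\mathbb E[\nu_d(\Psi_{r_0}(\Xi)\cap W_1)]=\mathbb E[\nu_d(\Xi\cap W_1)].$$ Then the estimator $$\widehat r_{\mathsf{max},N}=\sup\{r\ge0:\ 2\nu_d(\Psi_r(\Xi)\cap W_N)\ge\nu_d(\Xi\cap W_N)\}$$ is strongly consistent for $$r_{\mathsf{max}}=\sup\{r\ge0:\ \mathbb E[\nu_d(\Psi_r(\Xi)\cap[0,1]^d)]\ge\tfrac12\mathbb E[\nu_d(\Xi\cap[0,1]^d)]\},$$ i.e. $\widehat r_{\mathsf{max},N}\to r_{\mathsf{max}}$ almost surely as $N\to\infty$ ($N$ a positive integer).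
   Context: $\nu_d$ is $d$-dimensional Lebesgue measure; $B(x,r)$ is the closed ball; $\oplus$ is Minkowski addition; $B^{\ominus r}=\{x\in\mathbb R^d:B(x,r)\subset B\}$ is the erosion of a set $B$ by $B(o,r)$; $\Psi_r(\Xi)=\Xi^{\ominus r}\oplus B(o,r)$ is the opening. $W_N=[-N/2,N/2]^{d-1}\times[0,1]$. Suprema are taken in $[0,\infty]$. Random closed sets are measurable with respect to the Borel $\sigma$-algebra of the Fell topology on closed sets; the probability space $(\Omega,\mathcal A,\mathbb P)$ is complete. With $H_{\mathsf I}=\{x\in\mathbb R^d:x_d=0\}$, $\mathbb R^{d-1}$-stationary and ergodic means: there is a group $\{\mathbf T_x\}_{x\in H_{\mathsf I}}$ of $\mathbb P$-preserving maps $\mathbf T_x:\Omega\to\Omega$ with $\Xi(\mathbf T_x\omega)=\Xi(\omega)-x$, and $\Xi$ is stationary and ergodic with respect to this group. *)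

theory Defs
  imports "HOL-Probability.Probability" "HOL-Library.Set_Algebras"
begin

definition fell_topology :: "'a::topological_space set topology" where
  "fell_topology = topology_generated_by
     ({{F. closed F \<and> F \<inter> K = {}} |K. compact K} \<union>
      {{F. closed F \<and> F \<inter> G \<noteq> {}} |G. open G})"

definition fell_borel :: "'a::topological_space set measure" where
  "fell_borel = sigma {F. closed F} {U. openin fell_topology U}"

lemma topspace_fell_topology: "topspace fell_topology = {F. closed F}"
proof -
  have "{F::'a set. closed F} \<in> {{F. closed F \<and> F \<inter> K = {}} |K. compact K}"
    by (auto intro!: exI[of _ "{}"])
  then show ?thesis
    unfolding fell_topology_def topology_generated_by_topspace by auto
qed

lemma space_fell_borel: "space fell_borel = {F. closed F}"
  unfolding fell_borel_def
  by (rule space_measure_of) (metis Pow_iff mem_Collect_eq openin_subset subsetI topspace_fell_topology)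

definition random_closed_set :: "'w measure \<Rightarrow> ('w \<Rightarrow> 'a::topological_space set) \<Rightarrow> bool" where
  "random_closed_set M \<Xi> \<longleftrightarrow> \<Xi> \<in> measurable M fell_borel"

text \<open>Points of \<open>\<real>\<^sup>d\<close> are vectors \<open>x :: real ^ 'n\<close> with \<open>d = CARD('n)\<close>. The index
  type carries no order, so the coordinate that plays the role of \<open>x\<^sub>d\<close> is an explicit
  parameter \<open>l :: 'n\<close>.\<close>

definition hyperplane :: "'n::finite \<Rightarrow> (real ^ 'n) set" where
  "hyperplane l = {x. x $ l = 0}"

definition pres_group ::
    "'n::finite \<Rightarrow> 'w measure \<Rightarrow> (real ^ 'n \<Rightarrow> 'w \<Rightarrow> 'w) \<Rightarrow> bool" where
  "pres_group l M T \<longleftrightarrow>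
     (\<forall>x\<in>hyperplane l. T x \<in> measurable M M \<and> distr M M (T x) = M) \<and>
     (\<forall>\<omega>\<in>space M. T 0 \<omega> = \<omega>) \<and>
     (\<forall>x\<in>hyperplane l. \<forall>y\<in>hyperplane l. \<forall>\<omega>\<in>space M. T (x + y) \<omega> = T x (T y \<omega>))"

text \<open>Stationarity of \<open>\<Xi>\<close> is the covariance \<open>\<Xi>(T\<^sub>x \<omega>) = \<Xi>(\<omega>) - x\<close> together with the
  invariance of the measure. Ergodicity of \<open>\<Xi>\<close> with respect to \<open>T\<close> is triviality of
  the strictly \<open>T\<close>-invariant events in the sigma-algebra generated by \<open>\<Xi>\<close>. This is implied
  by triviality of all \<open>T\<close>-invariant events of \<open>M\<close>.\<close>

definition stationary_ergodic ::
    "'n::finite \<Rightarrow> 'w measure \<Rightarrow> ('w \<Rightarrow> (real ^ 'n) set) \<Rightarrow> bool" where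
  "stationary_ergodic l M \<Xi> \<longleftrightarrow>
     (\<exists>T. pres_group l M T \<and>
        (\<forall>x\<in>hyperplane l. \<forall>\<omega>\<in>space M. \<Xi> (T x \<omega>) = (\<lambda>y. y - x) ` \<Xi> \<omega>) \<and>
        (\<forall>A\<in>sets (vimage_algebra (space M) \<Xi> fell_borel).
           (\<forall>x\<in>hyperplane l. T x -` A \<inter> space M = A) \<longrightarrow> measure M A \<in> {0, 1}))"

definition erosion :: "real \<Rightarrow> 'a::metric_space set \<Rightarrow> 'a set" where
  "erosion r B = {x. cball x r \<subseteq> B}"

definition set_opening :: "real \<Rightarrow> 'a::real_normed_vector set \<Rightarrow> 'a set" where
  "set_opening r B = erosion r B + cball 0 r"

definition window :: "'n::finite \<Rightarrow> nat \<Rightarrow> (real ^ 'n) set" where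
  "window l N = {x. (\<forall>i. i \<noteq> l \<longrightarrow> - (real N / 2) \<le> x $ i \<and> x $ i \<le> real N / 2) \<and>
                    0 \<le> x $ l \<and> x $ l \<le> 1}"

definition rmax_est :: "'n::finite \<Rightarrow> nat \<Rightarrow> (real ^ 'n) set \<Rightarrow> ennreal" where
  "rmax_est l N X = Sup (ennreal ` {r. 0 \<le> r \<and>
     2 * measure lebesgue (set_opening r X \<inter> window l N) \<ge> measure lebesgue (X \<inter> window l N)})"

definition rmax :: "'w measure \<Rightarrow> ('w \<Rightarrow> (real ^ 'n::finite) set) \<Rightarrow> ennreal" where
  "rmax M \<Xi> = Sup (ennreal ` {r. 0 \<le> r \<and>
     (\<integral>\<omega>. measure lebesgue (set_opening r (\<Xi> \<omega>) \<inter> cbox 0 1) \<partial>M)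
       \<ge> 1 / 2 * (\<integral>\<omega>. measure lebesgue (\<Xi> \<omega> \<inter> cbox 0 1) \<partial>M)})"

end

theory Submission
  imports Defs
begin

text \<open>For fixed \<open>r\<close>, the volume of the opening in the window \<open>W\<^sub>N\<close> with \<open>N\<close> odd is the sum of the
  volumes in integer translates of \<open>W\<^sub>1\<close>, so the claim rests on an ergodic theorem for averages over
  lattice boxes. Averages converge in \<open>L\<^sup>2\<close> by a parallelogram argument. A limit along any
  subsequence is strictly invariant under all real shifts in the hyperplane, as shifting changes a box
  average only by a boundary term; hence it is constant by ergodicity. A maximal inequality, proved by
  Vitali covering, upgrades this to almost sure convergence. Even \<open>N\<close> are squeezed between odd ones.
  Finally, volumes are antimonotone in \<open>r\<close>, so convergence for rational \<open>r\<close> suffices; uniqueness of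
  \<open>r\<^sub>0\<close> makes the limit lie strictly above one half for \<open>r\<close> below the critical radius.\<close>

subsection \<open>Lattice boxes and a covering lemma\<close>

text \<open>Ergodicity is assumed for the full group of real shifts, and the subgroup of integer
  shifts may fail to be ergodic: a lattice-periodic pattern with a uniformly random offset is an
  example. Hence the lattice action carries no ergodicity assumption of its own, and the constancy
  of limits is supplied separately through real shifts. Moreover, triviality is known only for
  events that are strictly invariant and generated by \<open>\<Xi>\<close>, so invariance up to null
  sets is too weak. For this reason the limit is represented by a limsup, which is defined at every
  point and is a measurable function of the closed set. Uniqueness of the radius excludes that the
  mean volume ratio rests at one half on an interval, where random fluctuations would decide which
  radii the estimator accepts. It also forces the mean volume of \<open>\<Xi>\<close> in the unit
  window to be positive, since otherwise every radius would solve the equation.\<close>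

definition lattice_box :: "'n::finite \<Rightarrow> nat \<Rightarrow> (int ^ 'n) set" where
  "lattice_box l n = {z. z $ l = 0 \<and> (\<forall>i. i \<noteq> l \<longrightarrow> \<bar>z $ i\<bar> \<le> int n)}"

lemma lattice_box_eq_image:
  "lattice_box l n = vec_lambda ` (PiE UNIV (\<lambda>i. if i = l then {0} else {- int n..int n}))"
proof (intro set_eqI iffI)
  fix z assume z: "z \<in> lattice_box l n"
  have "vec_nth z \<in> PiE UNIV (\<lambda>i. if i = l then {0} else {- int n..int n})"
    using z by (force simp: lattice_box_def abs_le_iff)
  moreover have "z = vec_lambda (vec_nth z)" by (simp add: vec_eq_iff)
  ultimately show "z \<in> vec_lambda ` (PiE UNIV (\<lambda>i. if i = l then {0} else {- int n..int n}))"
    by blast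
next
  fix z assume "z \<in> vec_lambda ` (PiE UNIV (\<lambda>i. if i = l then {0} else {- int n..int n}))"
  then obtain g where g: "z = vec_lambda g"
    "\<And>i. g i \<in> (if i = l then {0} else {- int n..int n})" by (auto simp: PiE_iff)
  have "g l = 0" using g(2)[of l] by simp
  moreover have "\<bar>g i\<bar> \<le> int n" if "i \<noteq> l" for i
    using g(2)[of i] that by auto
  ultimately show "z \<in> lattice_box l n" by (auto simp: lattice_box_def g(1))
qed

lemma finite_lattice_box [simp]: "finite (lattice_box l n)"
  unfolding lattice_box_eq_image by (intro finite_imageI finite_PiE) auto

lemma card_lattice_box: "card (lattice_box (l::'n::finite) n) = (2 * n + 1) ^ (CARD('n) - 1)"
proof -
  have inj: "inj_on vec_lambda S" for S :: "('n \<Rightarrow> int) set"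
    by (metis inj_onI vec_lambda_inverse UNIV_I)
  have "card (lattice_box l n) = (\<Prod>i\<in>UNIV. card (if i = l then {0} else {- int n..int n}))"
    unfolding lattice_box_eq_image by (subst card_image[OF inj]) (simp add: card_PiE)
  also have "\<dots> = (\<Prod>i\<in>UNIV. if i = l then 1 else 2 * n + 1)"
    by (intro prod.cong) auto
  also have "\<dots> = (\<Prod>i\<in>UNIV - {l}. 2 * n + 1)"
    by (subst prod.remove[of _ l]) (auto intro: prod.cong)
  also have "\<dots> = (2 * n + 1) ^ (CARD('n) - 1)"
    by (simp add: card_Diff_singleton)
  finally show ?thesis .
qed

lemma card_lattice_box_pos [simp]: "card (lattice_box l n) > 0"
  by (simp add: card_lattice_box)

lemma lattice_box_nonempty: "lattice_box l n \<noteq> {}"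
  using card_lattice_box_pos[of l n] by (metis card.empty less_irrefl)

lemma lattice_box_plus:
  assumes "z \<in> lattice_box l m" "w \<in> lattice_box l n"
  shows "z + w \<in> lattice_box l (m + n)"
  unfolding lattice_box_def
proof (intro CollectI conjI allI impI)
  show "(z + w) $ l = 0" using assms by (simp add: lattice_box_def)
  fix i assume "i \<noteq> l"
  then have "\<bar>z $ i\<bar> \<le> int m" "\<bar>w $ i\<bar> \<le> int n" using assms by (simp_all add: lattice_box_def)
  then show "\<bar>(z + w) $ i\<bar> \<le> int (m + n)"
    by simp
qed

lemma lattice_box_mono: "m \<le> n \<Longrightarrow> lattice_box l m \<subseteq> lattice_box l n"
  unfolding lattice_box_def by force

lemma lattice_boxD: "z \<in> lattice_box l n \<Longrightarrow> z $ l = 0"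
  by (simp add: lattice_box_def)

lemma lattice_box_uminus: "z \<in> lattice_box l n \<Longrightarrow> - z \<in> lattice_box l n"
  by (simp add: lattice_box_def)

text \<open>Relative size of the shell of width \<open>m\<close> around a lattice box. Its decay for
  fixed \<open>m\<close> is the Folner property of the boxes; every error made by shifting a box is
  measured in it.\<close>

definition box_excess :: "'n::finite \<Rightarrow> nat \<Rightarrow> nat \<Rightarrow> real" where
  "box_excess l n m = real (card (lattice_box l (n + m))) / real (card (lattice_box l n)) - 1"

lemma box_excess_tendsto: "(\<lambda>n. box_excess (l::'n::finite) n m) \<longlonglongrightarrow> 0"
proof -
  have eq: "box_excess l n m
      = (1 + 2 * real m * inverse (real (2 * n + 1))) ^ (CARD('n) - 1) - 1" for n
    unfolding box_excess_def card_lattice_box of_nat_power power_divide[symmetric]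
    by (simp add: field_simps)
  have "(\<lambda>n. inverse (real (2 * n + 1))) \<longlonglongrightarrow> 0"
    by (intro tendsto_inverse_0_at_top filterlim_compose[OF filterlim_real_sequentially]
        filterlim_subseq) (auto simp: strict_mono_def)
  then have "(\<lambda>n. (1 + 2 * real m * inverse (real (2 * n + 1))) ^ (CARD('n) - 1) - 1)
      \<longlonglongrightarrow> (1 + 2 * real m * 0) ^ (CARD('n) - 1) - 1"
    by (intro tendsto_intros)
  then show ?thesis by (simp add: eq)
qed

text \<open>The shifted box lies in the box enlarged by \<open>m\<close>, and each additional point
  contributes at most 1.\<close>

lemma sum_shifted_box_le:
  fixes F :: "int ^ 'n \<Rightarrow> real"
  assumes w: "w \<in> lattice_box l m" and F: "\<And>z. z $ l = 0 \<Longrightarrow> 0 \<le> F z \<and> F z \<le> 1"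
  shows "(\<Sum>z\<in>lattice_box l n. F (z + w))
    \<le> (\<Sum>z\<in>lattice_box l n. F z) + box_excess l n m * card (lattice_box l n)"
proof -
  have "(\<Sum>z\<in>lattice_box l n. F (z + w)) = (\<Sum>z\<in>(\<lambda>z. z + w) ` lattice_box l n. F z)"
    by (subst sum.reindex) (auto simp: inj_on_def)
  also have "\<dots> \<le> (\<Sum>z\<in>lattice_box l (n + m). F z)"
    by (intro sum_mono2) (use w F in \<open>auto intro: lattice_box_plus dest: lattice_boxD\<close>)
  also have "\<dots> = (\<Sum>z\<in>lattice_box l n. F z) + (\<Sum>z\<in>lattice_box l (n + m) - lattice_box l n. F z)"
    by (subst add.commute, rule sum.subset_diff) (use lattice_box_mono[of n "n + m" l] in auto)
  also have "(\<Sum>z\<in>lattice_box l (n + m) - lattice_box l n. F z)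
      \<le> (\<Sum>z\<in>lattice_box l (n + m) - lattice_box l n. 1)"
    by (intro sum_mono) (use F in \<open>auto dest: lattice_boxD\<close>)
  also have "\<dots> = real (card (lattice_box l (n + m))) - real (card (lattice_box l n))"
    by (simp add: card_Diff_subset lattice_box_mono card_mono of_nat_diff)
  also have "\<dots> = box_excess l n m * card (lattice_box l n)"
    by (simp add: box_excess_def field_simps lattice_box_nonempty)
  finally show ?thesis by simp
qed

text \<open>The missing lower bound is the upper bound applied to \<open>1 - F\<close>.\<close>

lemma sum_shifted_box_diff_le:
  fixes F :: "int ^ 'n \<Rightarrow> real"
  assumes w: "w \<in> lattice_box l m" and F: "\<And>z. z $ l = 0 \<Longrightarrow> 0 \<le> F z \<and> F z \<le> 1"
  shows "\<bar>(\<Sum>z\<in>lattice_box l n. F (z + w)) - (\<Sum>z\<in>lattice_box l n. F z)\<bar>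
    \<le> box_excess l n m * card (lattice_box l n)"
  using sum_shifted_box_le[OF w, of F n] sum_shifted_box_le[OF w, of "\<lambda>z. 1 - F z" n] F
  by (simp add: sum_subtractf abs_le_iff)

text \<open>Greedy selection by decreasing radius.\<close>

lemma lattice_vitali_cover:
  fixes \<rho> :: "int ^ 'n \<Rightarrow> nat"
  assumes "finite S" "\<And>z. z \<in> S \<Longrightarrow> z $ l = 0"
  shows "\<exists>C\<subseteq>S. disjoint_family_on (\<lambda>c. (+) c ` lattice_box l (\<rho> c)) C \<and>
    S \<subseteq> (\<Union>c\<in>C. (+) c ` lattice_box l (2 * \<rho> c))"
  using assms
proof (induction S rule: finite_psubset_induct)
  case (psubset S)
  show ?case
  proof (cases "S = {}")
    case True
    then show ?thesis by (auto simp: disjoint_family_on_def)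
  next
    case False
    define Q where "Q = (\<lambda>c. (+) c ` lattice_box l (\<rho> c))"
    obtain c where c: "c \<in> S" "\<And>z. z \<in> S \<Longrightarrow> \<rho> z \<le> \<rho> c"
      using Max_in[of "\<rho> ` S"] Max_ge[of "\<rho> ` S"] False psubset.hyps by fastforce
    \<comment> \<open>Discarding the points whose boxes meet the largest one also discards
      \<open>c\<close> itself, so the induction hypothesis applies.\<close>
    define S' where "S' = {z\<in>S. Q z \<inter> Q c = {}}"
    have "c \<in> Q c" by (force simp: Q_def lattice_box_def)
    then have "S' \<subset> S" using c by (auto simp: S'_def)
    then obtain C where C: "C \<subseteq> S'" "disjoint_family_on Q C"
      "S' \<subseteq> (\<Union>c\<in>C. (+) c ` lattice_box l (2 * \<rho> c))"
      using psubset.IH[of S'] psubset.prems unfolding Q_def by blast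
    \<comment> \<open>Centres of two meeting boxes are at most
      \<open>\<rho> z + \<rho> c \<le> 2 * \<rho> c\<close> apart in each coordinate; hence the
      doubled radius.\<close>
    have near: "z \<in> (+) c ` lattice_box l (2 * \<rho> c)" if z: "z \<in> S" "z \<notin> S'" for z
    proof -
      obtain u v where uv: "u \<in> lattice_box l (\<rho> z)" "v \<in> lattice_box l (\<rho> c)" "z + u = c + v"
        using z by (auto simp: S'_def Q_def)
      have "v + - u \<in> lattice_box l (\<rho> c + \<rho> c)"
        by (intro lattice_box_plus uv subsetD[OF lattice_box_mono[OF c(2)[OF z(1)]]]
            lattice_box_uminus)
      moreover have "z = c + (v + - u)" using uv(3) by (simp add: algebra_simps)
      ultimately show ?thesis by (auto simp: mult_2)
    qed
    show ?thesis
    proof (intro exI[of _ "insert c C"] conjI)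
      show "insert c C \<subseteq> S" using c C by (auto simp: S'_def)
      show "disjoint_family_on (\<lambda>c. (+) c ` lattice_box l (\<rho> c)) (insert c C)"
        using C(1,2) unfolding Q_def[symmetric] disjoint_family_on_def S'_def by blast
      show "S \<subseteq> (\<Union>c\<in>insert c C. (+) c ` lattice_box l (2 * \<rho> c))"
        using near C(3) by blast
    qed
  qed
qed

text \<open>The selected boxes are disjoint, so their sums of \<open>F\<close> add up to at most the
  sum over \<open>Q\<close>, while their doubled copies cover \<open>S\<close>. The constant is the
  price of doubling.\<close>

lemma lattice_maximal_bound:
  fixes F :: "int ^ 'n \<Rightarrow> real" and \<rho> :: "int ^ 'n \<Rightarrow> nat" and \<epsilon> :: real
  assumes S: "finite S" "\<And>z. z \<in> S \<Longrightarrow> z $ l = 0" and Q: "finite Q"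
    and F: "\<And>z. z \<in> Q \<Longrightarrow> F z \<ge> 0"
    and sub: "\<And>z. z \<in> S \<Longrightarrow> (+) z ` lattice_box l (\<rho> z) \<subseteq> Q"
    and large: "\<And>z. z \<in> S \<Longrightarrow>
      (\<Sum>w\<in>lattice_box l (\<rho> z). F (z + w)) \<ge> \<epsilon> * card (lattice_box l (\<rho> z))"
    and \<epsilon>: "\<epsilon> > 0"
  shows "\<epsilon> * card S \<le> 2 ^ (CARD('n) - 1) * (\<Sum>y\<in>Q. F y)"
proof -
  obtain C where C: "C \<subseteq> S" "disjoint_family_on (\<lambda>c. (+) c ` lattice_box l (\<rho> c)) C"
    "S \<subseteq> (\<Union>c\<in>C. (+) c ` lattice_box l (2 * \<rho> c))"
    using lattice_vitali_cover[of S l \<rho>] S by auto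
  have finC: "finite C" using C(1) S(1) finite_subset by blast
  \<comment> \<open>\<open>4 * n + 1 \<le> 2 * (2 * n + 1)\<close> in each of the
    \<open>CARD('n) - 1\<close> free coordinates.\<close>
  have dbl: "card (lattice_box l (2 * n)) \<le> 2 ^ (CARD('n) - 1) * card (lattice_box l n)" for n
    unfolding card_lattice_box power_mult_distrib[symmetric] by (intro power_mono) auto
  have inj: "inj_on ((+) c) X" for c :: "int ^ 'n" and X by (auto simp: inj_on_def)
  have "card S \<le> card (\<Union>c\<in>C. (+) c ` lattice_box l (2 * \<rho> c))"
    by (intro card_mono C(3)) (use finC in auto)
  also have "\<dots> \<le> (\<Sum>c\<in>C. card ((+) c ` lattice_box l (2 * \<rho> c)))"
    by (rule card_UN_le[OF finC])
  also have "\<dots> \<le> (\<Sum>c\<in>C. 2 ^ (CARD('n) - 1) * card (lattice_box l (\<rho> c)))"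
    by (intro sum_mono) (simp only: card_image[OF inj] dbl)
  finally have "real (card S) \<le> real (\<Sum>c\<in>C. 2 ^ (CARD('n) - 1) * card (lattice_box l (\<rho> c)))"
    by (rule of_nat_mono)
  then have "\<epsilon> * card S \<le> \<epsilon> * real (\<Sum>c\<in>C. 2 ^ (CARD('n) - 1) * card (lattice_box l (\<rho> c)))"
    using \<epsilon> by (intro mult_left_mono) auto
  also have "\<dots> = 2 ^ (CARD('n) - 1) * (\<Sum>c\<in>C. \<epsilon> * card (lattice_box l (\<rho> c)))"
    by (simp add: sum_distrib_left mult_ac)
  also have "\<dots> \<le> 2 ^ (CARD('n) - 1) * (\<Sum>c\<in>C. \<Sum>w\<in>lattice_box l (\<rho> c). F (c + w))"
    using C(1) large by (intro mult_left_mono sum_mono) auto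
  also have "(\<Sum>c\<in>C. \<Sum>w\<in>lattice_box l (\<rho> c). F (c + w))
      = (\<Sum>c\<in>C. \<Sum>y\<in>(+) c ` lattice_box l (\<rho> c). F y)"
    by (simp add: sum.reindex[OF inj])
  also have "\<dots> = (\<Sum>y\<in>(\<Union>c\<in>C. (+) c ` lattice_box l (\<rho> c)). F y)"
    by (rule sum.UNION_disjoint[symmetric])
      (use finC C(2) in \<open>auto simp: disjoint_family_on_def\<close>)
  also have "\<dots> \<le> (\<Sum>y\<in>Q. F y)"
    using C(1) sub by (intro sum_mono2[OF Q] F) auto
  finally show ?thesis by simp
qed

subsection \<open>Ergodic averages over lattice boxes\<close>

text \<open>Ergodicity is absent on purpose: it may fail for integer shifts, and enters
  \<open>ergodic_theorem\<close> as a property of limits instead.\<close>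

locale lattice_action = prob_space M for M :: "'w measure" +
  fixes l :: "'n::finite" and \<tau> :: "int ^ 'n \<Rightarrow> 'w \<Rightarrow> 'w"
  assumes \<tau>_measurable: "z $ l = 0 \<Longrightarrow> \<tau> z \<in> measurable M M"
    and \<tau>_distr: "z $ l = 0 \<Longrightarrow> distr M M (\<tau> z) = M"
    and \<tau>_add: "z $ l = 0 \<Longrightarrow> w $ l = 0 \<Longrightarrow> \<omega> \<in> space M \<Longrightarrow> \<tau> (z + w) \<omega> = \<tau> z (\<tau> w \<omega>)"
begin

definition avg :: "nat \<Rightarrow> ('w \<Rightarrow> real) \<Rightarrow> 'w \<Rightarrow> real" where
  "avg n g \<omega> = (\<Sum>z\<in>lattice_box l n. g (\<tau> z \<omega>)) / real (card (lattice_box l n))"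

lemma \<tau>_space: "z $ l = 0 \<Longrightarrow> \<omega> \<in> space M \<Longrightarrow> \<tau> z \<omega> \<in> space M"
  using measurable_space[OF \<tau>_measurable] .

lemma \<tau>_box_space: "z \<in> lattice_box l n \<Longrightarrow> \<omega> \<in> space M \<Longrightarrow> \<tau> z \<omega> \<in> space M"
  by (rule \<tau>_space[OF lattice_boxD])

lemma \<tau>_add_box:
  "z \<in> lattice_box l n \<Longrightarrow> w \<in> lattice_box l m \<Longrightarrow> \<omega> \<in> space M \<Longrightarrow> \<tau> w (\<tau> z \<omega>) = \<tau> (z + w) \<omega>"
  using \<tau>_add[OF lattice_boxD lattice_boxD] by (metis add.commute)

lemma measurable_comp_\<tau>: "z $ l = 0 \<Longrightarrow> g \<in> measurable M N \<Longrightarrow> (\<lambda>\<omega>. g (\<tau> z \<omega>)) \<in> measurable M N"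
  using measurable_compose[OF \<tau>_measurable] .

lemma integral_comp_\<tau>:
  fixes g :: "'w \<Rightarrow> real"
  assumes "z $ l = 0" "g \<in> borel_measurable M"
  shows "(\<integral>\<omega>. g (\<tau> z \<omega>) \<partial>M) = (\<integral>\<omega>. g \<omega> \<partial>M)"
  using integral_distr[OF \<tau>_measurable[OF assms(1)], of g] assms by (simp add: \<tau>_distr)

lemma integrable_comp_\<tau>:
  fixes g :: "'w \<Rightarrow> real"
  assumes "z $ l = 0" "integrable M g"
  shows "integrable M (\<lambda>\<omega>. g (\<tau> z \<omega>))"
  using integrable_distr_eq[OF \<tau>_measurable[OF assms(1)], of g] assms by (simp add: \<tau>_distr)

lemma avg_measurable:
  assumes "g \<in> borel_measurable M"
  shows "avg n g \<in> borel_measurable M"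
proof -
  have "(\<lambda>\<omega>. g (\<tau> z \<omega>)) \<in> borel_measurable M" if "z \<in> lattice_box l n" for z
    using measurable_comp_\<tau>[OF lattice_boxD[OF that] assms] .
  then show ?thesis
    unfolding avg_def by (intro borel_measurable_divide borel_measurable_sum borel_measurable_const)
qed

lemma avg_integrable: "integrable M g \<Longrightarrow> integrable M (avg n g)"
  unfolding avg_def
  by (intro Bochner_Integration.integrable_divide Bochner_Integration.integrable_sum integrable_comp_\<tau>)
    (auto dest: lattice_boxD)

lemma expectation_avg:
  assumes "integrable M g"
  shows "expectation (avg n g) = expectation g"
proof -
  have "expectation (avg n g)
      = (\<Sum>z\<in>lattice_box l n. expectation (\<lambda>\<omega>. g (\<tau> z \<omega>))) / real (card (lattice_box l n))"
    unfolding avg_def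
    by (subst integral_divide_zero, subst Bochner_Integration.integral_sum)
      (auto intro: integrable_comp_\<tau> assms dest: lattice_boxD)
  also have "(\<Sum>z\<in>lattice_box l n. expectation (\<lambda>\<omega>. g (\<tau> z \<omega>)))
      = (\<Sum>z\<in>lattice_box l n. expectation g)"
    by (intro sum.cong refl integral_comp_\<tau>) (use assms in \<open>auto dest: lattice_boxD\<close>)
  finally show ?thesis by (simp add: lattice_box_nonempty)
qed

lemma avg_mono:
  assumes "\<And>\<omega>. \<omega> \<in> space M \<Longrightarrow> g \<omega> \<le> h \<omega>" "\<omega> \<in> space M"
  shows "avg n g \<omega> \<le> avg n h \<omega>"
  unfolding avg_def using assms by (intro divide_right_mono sum_mono) (simp_all add: \<tau>_box_space)

lemma avg_const: "avg n (\<lambda>_. c) \<omega> = c"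
  by (simp add: avg_def lattice_box_nonempty)

lemma avg_diff: "avg n (\<lambda>\<omega>. g \<omega> - h \<omega>) \<omega> = avg n g \<omega> - avg n h \<omega>"
  by (simp add: avg_def sum_subtractf diff_divide_distrib)

lemma avg_mean: "avg n (\<lambda>\<omega>. (g \<omega> + h \<omega>) / 2) \<omega> = (avg n g \<omega> + avg n h \<omega>) / 2"
  by (simp add: avg_def sum.distrib sum_divide_distrib[symmetric] add_divide_distrib mult.commute)

lemma avg_abs: "\<bar>avg n g \<omega>\<bar> \<le> avg n (\<lambda>\<omega>. \<bar>g \<omega>\<bar>) \<omega>"
  by (simp add: avg_def abs_divide divide_right_mono)

lemma avg_bounds:
  assumes "\<And>\<omega>. \<omega> \<in> space M \<Longrightarrow> 0 \<le> g \<omega> \<and> g \<omega> \<le> 1" "\<omega> \<in> space M"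
  shows "0 \<le> avg n g \<omega> \<and> avg n g \<omega> \<le> 1"
  using avg_mono[of "\<lambda>_. 0" g \<omega> n] avg_mono[of g "\<lambda>_. 1" \<omega> n] assms by (simp add: avg_const)

lemma integrable_unit:
  assumes "g \<in> borel_measurable M" "\<And>\<omega>. \<omega> \<in> space M \<Longrightarrow> 0 \<le> g \<omega> \<and> g \<omega> \<le> (1::real)"
  shows "integrable M g"
  by (rule integrable_const_bound[where B = 1]) (use assms in auto)

lemma avg_square_le: "(avg n g \<omega>)\<^sup>2 \<le> avg n (\<lambda>\<omega>. (g \<omega>)\<^sup>2) \<omega>"
proof -
  let ?c = "real (card (lattice_box l n))"
  have c: "?c > 0" by (simp add: card_gt_0_iff lattice_box_nonempty)
  have "(\<Sum>z\<in>lattice_box l n. g (\<tau> z \<omega>))\<^sup>2 \<le> ?c * (\<Sum>z\<in>lattice_box l n. (g (\<tau> z \<omega>))\<^sup>2)"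
    using Cauchy_Schwarz_ineq_sum[of "\<lambda>_. 1" "\<lambda>z. g (\<tau> z \<omega>)" "lattice_box l n"] by simp
  then show ?thesis
    using c by (simp add: avg_def power_divide divide_le_eq power2_eq_square field_simps)
qed

text \<open>Averaging contracts the L2 norm: Cauchy-Schwarz at each point, then invariance of the
  measure.\<close>

lemma expectation_avg_square_le:
  assumes "g \<in> borel_measurable M" "\<And>\<omega>. \<omega> \<in> space M \<Longrightarrow> 0 \<le> g \<omega> \<and> g \<omega> \<le> 1"
  shows "expectation (\<lambda>\<omega>. (avg n g \<omega>)\<^sup>2) \<le> expectation (\<lambda>\<omega>. (g \<omega>)\<^sup>2)"
proof -
  have i: "integrable M (\<lambda>\<omega>. (g \<omega>)\<^sup>2)"
    by (rule integrable_unit) (use assms in \<open>auto simp: power_le_one\<close>)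
  have "expectation (\<lambda>\<omega>. (avg n g \<omega>)\<^sup>2) \<le> expectation (avg n (\<lambda>\<omega>. (g \<omega>)\<^sup>2))"
    by (intro integral_mono integrable_unit avg_integrable i avg_square_le)
      (use avg_bounds[OF assms(2)] avg_measurable[OF assms(1)] in \<open>auto simp: power_le_one\<close>)
  then show ?thesis by (simp add: expectation_avg[OF i])
qed

text \<open>Swapping the two sums turns the double average into a mean of averages over shifted
  boxes, and each shift costs only a boundary term. The bound is uniform in \<open>\<omega>\<close>
  and vanishes as \<open>n\<close> grows with \<open>m\<close> fixed.\<close>

lemma avg_avg_diff_le:
  assumes \<omega>: "\<omega> \<in> space M" and f: "\<And>\<omega>. \<omega> \<in> space M \<Longrightarrow> 0 \<le> f \<omega> \<and> f \<omega> \<le> 1"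
  shows "\<bar>avg n (avg m f) \<omega> - avg n f \<omega>\<bar> \<le> box_excess l n m"
proof -
  let ?c = "\<lambda>n. real (card (lattice_box l n))"
  define F where "F = (\<lambda>z. f (\<tau> z \<omega>))"
  have c: "?c n > 0" for n by (simp add: card_gt_0_iff lattice_box_nonempty)
  have F: "z $ l = 0 \<Longrightarrow> 0 \<le> F z \<and> F z \<le> 1" for z
    unfolding F_def by (intro f \<tau>_space \<omega>)
  have "avg n (avg m f) \<omega> = (\<Sum>z\<in>lattice_box l n. \<Sum>w\<in>lattice_box l m. F (z + w)) / ?c m / ?c n"
    unfolding avg_def sum_divide_distrib[symmetric] F_def
    by (intro arg_cong2[of _ _ _ _ "(/)"] refl sum.cong)
      (use \<omega> in \<open>simp add: \<tau>_add_box\<close>)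
  also have "\<dots> = (\<Sum>w\<in>lattice_box l m. \<Sum>z\<in>lattice_box l n. F (z + w)) / ?c m / ?c n"
    by (subst sum.swap) simp
  finally have 1: "avg n (avg m f) \<omega> =
      (\<Sum>w\<in>lattice_box l m. \<Sum>z\<in>lattice_box l n. F (z + w)) / ?c m / ?c n" .
  have 2: "avg n f \<omega> = (\<Sum>w\<in>lattice_box l m. \<Sum>z\<in>lattice_box l n. F z) / ?c m / ?c n"
    by (simp add: avg_def F_def lattice_box_nonempty)
  have "\<bar>avg n (avg m f) \<omega> - avg n f \<omega>\<bar> =
      \<bar>\<Sum>w\<in>lattice_box l m. ((\<Sum>z\<in>lattice_box l n. F (z + w)) - (\<Sum>z\<in>lattice_box l n. F z))\<bar> / ?c m / ?c n"
    unfolding 1 2 by (simp only: sum_subtractf diff_divide_distrib[symmetric] abs_divide abs_of_nat)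
  also have "\<dots> \<le> (\<Sum>w\<in>lattice_box l m. box_excess l n m * ?c n) / ?c m / ?c n"
    by (intro divide_right_mono order_trans[OF sum_abs] sum_mono sum_shifted_box_diff_le F) auto
  also have "\<dots> = box_excess l n m"
    by (simp add: lattice_box_nonempty)
  finally show ?thesis .
qed

text \<open>Transference: the covering bound is applied to the orbit of a point over a large box and then
  integrated.\<close>

lemma maximal_inequality_bounded:
  assumes h: "h \<in> borel_measurable M" "\<And>\<omega>. \<omega> \<in> space M \<Longrightarrow> 0 \<le> h \<omega>" "integrable M h"
    and \<epsilon>: "\<epsilon> > 0"
  shows "\<epsilon> * prob {\<omega>\<in>space M. \<exists>n\<le>R. avg n h \<omega> > \<epsilon>} \<le> 2 ^ (CARD('n) - 1) * expectation h"
proof -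
  let ?K = "2 ^ (CARD('n) - 1) :: real"
  define E where "E = {\<omega>\<in>space M. \<exists>n\<le>R. avg n h \<omega> > \<epsilon>}"
  have [measurable]: "avg n h \<in> borel_measurable M" for n by (rule avg_measurable[OF h(1)])
  have E: "E \<in> sets M" unfolding E_def by measurable
  \<comment> \<open>\<open>L\<close> is the radius of an auxiliary box of starting points. Boxes of
    radius at most \<open>R\<close> around them stay inside radius \<open>L + R\<close>, and the
    loss factor \<open>1 + box_excess l L R\<close> tends to 1 as \<open>L\<close> grows.\<close>
  have step: "\<epsilon> * prob E \<le> ?K * expectation h * (1 + box_excess l L R)" for L
  proof -
    have pt: "\<epsilon> * (\<Sum>z\<in>lattice_box l L. indicator E (\<tau> z \<omega>))
        \<le> ?K * (\<Sum>y\<in>lattice_box l (L + R). h (\<tau> y \<omega>))" if \<omega>: "\<omega> \<in> space M" for \<omega>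
    proof -
      define S where "S = {z\<in>lattice_box l L. \<tau> z \<omega> \<in> E}"
      have "\<exists>n\<le>R. avg n h (\<tau> z \<omega>) > \<epsilon>" if "z \<in> S" for z
        using that by (auto simp: S_def E_def)
      then obtain \<rho> where \<rho>: "\<And>z. z \<in> S \<Longrightarrow> \<rho> z \<le> R" "\<And>z. z \<in> S \<Longrightarrow> avg (\<rho> z) h (\<tau> z \<omega>) > \<epsilon>"
        by metis
      have "\<epsilon> * card S \<le> ?K * (\<Sum>y\<in>lattice_box l (L + R). h (\<tau> y \<omega>))"
      proof (rule lattice_maximal_bound[where l = l and \<rho> = \<rho>])
        show "finite S" by (simp add: S_def)
        show "z $ l = 0" if "z \<in> S" for z using that by (auto simp: S_def dest: lattice_boxD)
        show "0 \<le> h (\<tau> y \<omega>)" if "y \<in> lattice_box l (L + R)" for y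
          using that h(2) \<tau>_box_space \<omega> by blast
        show "(+) z ` lattice_box l (\<rho> z) \<subseteq> lattice_box l (L + R)" if "z \<in> S" for z
          using that \<rho>(1)[OF that] lattice_box_mono[of "\<rho> z" R l]
          by (auto simp: S_def intro: lattice_box_plus)
        show "(\<Sum>w\<in>lattice_box l (\<rho> z). h (\<tau> (z + w) \<omega>)) \<ge> \<epsilon> * card (lattice_box l (\<rho> z))"
          if z: "z \<in> S" for z
        proof -
          have "(\<Sum>w\<in>lattice_box l (\<rho> z). h (\<tau> (z + w) \<omega>)) = (\<Sum>w\<in>lattice_box l (\<rho> z). h (\<tau> w (\<tau> z \<omega>)))"
            using z \<omega>
            by (intro sum.cong refl arg_cong[where f = h] \<tau>_add_box[where n = L and m = "\<rho> z", symmetric])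
              (auto simp: S_def)
          moreover have "\<epsilon> * card (lattice_box l (\<rho> z)) < (\<Sum>w\<in>lattice_box l (\<rho> z). h (\<tau> w (\<tau> z \<omega>)))"
            using \<rho>(2)[OF z] by (simp add: avg_def pos_less_divide_eq)
          ultimately show ?thesis by linarith
        qed
      qed (use \<epsilon> in auto)
      moreover have "(\<Sum>z\<in>lattice_box l L. indicator E (\<tau> z \<omega>)) = real (card S)"
        unfolding S_def by (simp add: indicator_def sum.If_cases Int_def)
      ultimately show ?thesis by simp
    qed
    have "\<epsilon> * (card (lattice_box l L) * prob E)
        = expectation (\<lambda>\<omega>. \<epsilon> * (\<Sum>z\<in>lattice_box l L. indicator E (\<tau> z \<omega>)))"
    proof -
      have "expectation (\<lambda>\<omega>. indicator E (\<tau> z \<omega>)) = prob E" if "z \<in> lattice_box l L" for z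
        using integral_comp_\<tau>[of z "indicator E"] E that
        by (auto dest: lattice_boxD)
      moreover have "integrable M (\<lambda>\<omega>. indicator E (\<tau> z \<omega>) :: real)" if "z \<in> lattice_box l L" for z
        using that E by (intro integrable_comp_\<tau> integrable_unit) (auto dest: lattice_boxD simp: indicator_def)
      ultimately show ?thesis
        by (simp add: Bochner_Integration.integral_sum)
    qed
    also have "\<dots> \<le> expectation (\<lambda>\<omega>. ?K * (\<Sum>y\<in>lattice_box l (L + R). h (\<tau> y \<omega>)))"
      by (intro integral_mono pt integrable_mult_right Bochner_Integration.integrable_sum integrable_comp_\<tau> integrable_unit h)
        (use E in \<open>auto dest: lattice_boxD simp: indicator_def\<close>)
    also have "\<dots> = ?K * (card (lattice_box l (L + R)) * expectation h)"
    proof -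
      have "expectation (\<lambda>\<omega>. \<Sum>y\<in>lattice_box l (L + R). h (\<tau> y \<omega>))
          = (\<Sum>y\<in>lattice_box l (L + R). expectation (\<lambda>\<omega>. h (\<tau> y \<omega>)))"
        by (intro Bochner_Integration.integral_sum integrable_comp_\<tau> h) (auto dest: lattice_boxD)
      also have "\<dots> = (\<Sum>y\<in>lattice_box l (L + R). expectation h)"
        by (intro sum.cong refl integral_comp_\<tau> h) (auto dest: lattice_boxD)
      finally show ?thesis by simp
    qed
    finally show ?thesis
      by (simp add: box_excess_def field_simps lattice_box_nonempty)
  qed
  have "(\<lambda>L. ?K * expectation h * (1 + box_excess l L R)) \<longlonglongrightarrow> ?K * expectation h * (1 + 0)"
    by (intro tendsto_intros box_excess_tendsto)
  then have "\<epsilon> * prob E \<le> ?K * expectation h * (1 + 0)"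
    by (rule LIMSEQ_le_const) (use step in auto)
  then show ?thesis by (simp add: E_def)
qed

text \<open>The cutoff \<open>R\<close>, which kept all boxes in one finite piece of the orbit, is
  removed by continuity of the measure from below.\<close>

lemma maximal_inequality:
  assumes h: "h \<in> borel_measurable M" "\<And>\<omega>. \<omega> \<in> space M \<Longrightarrow> 0 \<le> h \<omega>" "integrable M h"
    and \<epsilon>: "\<epsilon> > 0"
  shows "\<epsilon> * prob {\<omega>\<in>space M. \<exists>n. avg n h \<omega> > \<epsilon>} \<le> 2 ^ (CARD('n) - 1) * expectation h"
proof -
  define E where "E = (\<lambda>R::nat. {\<omega>\<in>space M. \<exists>n\<le>R. avg n h \<omega> > \<epsilon>})"
  have [measurable]: "avg n h \<in> borel_measurable M" for n by (rule avg_measurable[OF h(1)])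
  have "E R \<in> sets M" for R unfolding E_def by measurable
  then have "(\<lambda>R. prob (E R)) \<longlonglongrightarrow> prob (\<Union>R. E R)"
    by (intro finite_Lim_measure_incseq) (auto simp: incseq_def E_def intro: order_trans)
  then have "(\<lambda>R. \<epsilon> * prob (E R)) \<longlonglongrightarrow> \<epsilon> * prob (\<Union>R. E R)"
    by (intro tendsto_intros)
  then have "\<epsilon> * prob (\<Union>R. E R) \<le> 2 ^ (CARD('n) - 1) * expectation h"
    by (rule LIMSEQ_le_const2) (use maximal_inequality_bounded[OF h \<epsilon>] in \<open>auto simp: E_def\<close>)
  moreover have "(\<Union>R. E R) = {\<omega>\<in>space M. \<exists>n. avg n h \<omega> > \<epsilon>}"
    by (auto simp: E_def)
  ultimately show ?thesis by simp
qed

text \<open>Parallelogram argument: \<open>E (avg n f)\<^sup>2\<close> converges to its infimum \<open>c\<close> because \<open>avg n (avg m f)\<close>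
  and \<open>avg n f\<close> are uniformly close, and the mean of two averages cannot have second moment
  below \<open>c\<close>.\<close>

lemma avg_L2_Cauchy:
  assumes f: "f \<in> borel_measurable M" "\<And>\<omega>. \<omega> \<in> space M \<Longrightarrow> 0 \<le> f \<omega> \<and> f \<omega> \<le> 1"
    and \<delta>: "\<delta> > 0"
  shows "\<exists>N. \<forall>n\<ge>N. \<forall>m\<ge>N. expectation (\<lambda>\<omega>. (avg n f \<omega> - avg m f \<omega>)\<^sup>2) < \<delta>"
proof -
  define v where "v = (\<lambda>n. expectation (\<lambda>\<omega>. (avg n f \<omega>)\<^sup>2))"
  define c where "c = Inf (range v)"
  have [measurable]: "f \<in> borel_measurable M" "avg n f \<in> borel_measurable M" for n
    using f(1) avg_measurable by auto
  have fb: "0 \<le> avg n f \<omega> \<and> avg n f \<omega> \<le> 1" if "\<omega> \<in> space M" for n \<omega>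
    using f(2) that by (rule avg_bounds)
  have close: "\<bar>avg n (avg m f) \<omega> - avg n f \<omega>\<bar> \<le> box_excess l n m" if "\<omega> \<in> space M" for n m \<omega>
    using that f(2) by (rule avg_avg_diff_le)
  have v_nonneg: "v n \<ge> 0" for n unfolding v_def by simp
  have c_le: "c \<le> v n" for n
    unfolding c_def by (intro cINF_lower bdd_belowI[of _ 0]) (use v_nonneg in auto)
  \<comment> \<open>Squares are 2-Lipschitz on [0,1], and \<open>avg n\<close> is an L2 contraction.
    This is used both for \<open>g = avg m0 f\<close> and for the mean of two averages.\<close>
  have v_le: "v n \<le> expectation (\<lambda>\<omega>. (g \<omega>)\<^sup>2) + 2 * e"
    if g: "g \<in> borel_measurable M" "\<And>\<omega>. \<omega> \<in> space M \<Longrightarrow> 0 \<le> g \<omega> \<and> g \<omega> \<le> 1"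
      and e: "\<And>\<omega>. \<omega> \<in> space M \<Longrightarrow> \<bar>avg n g \<omega> - avg n f \<omega>\<bar> \<le> e" for n g e
  proof -
    have gb: "0 \<le> avg n g \<omega> \<and> avg n g \<omega> \<le> 1" if "\<omega> \<in> space M" for \<omega>
      using g(2) that by (rule avg_bounds)
    have pt: "(avg n f \<omega>)\<^sup>2 \<le> (avg n g \<omega>)\<^sup>2 + 2 * e" if \<omega>: "\<omega> \<in> space M" for \<omega>
    proof -
      have b: "0 \<le> avg n f \<omega>" "avg n f \<omega> \<le> 1" "0 \<le> avg n g \<omega>" "avg n g \<omega> \<le> 1"
        using fb[OF \<omega>, of n] gb[OF \<omega>] by auto
      have "(avg n f \<omega>)\<^sup>2 - (avg n g \<omega>)\<^sup>2 = (avg n f \<omega> - avg n g \<omega>) * (avg n f \<omega> + avg n g \<omega>)"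
        by (simp add: power2_eq_square algebra_simps)
      also have "\<dots> \<le> e * 2"
        using b e[OF \<omega>] by (intro mult_mono) auto
      finally show ?thesis by simp
    qed
    have [measurable]: "avg n g \<in> borel_measurable M" by (rule avg_measurable[OF g(1)])
    have i: "integrable M (\<lambda>\<omega>. (avg n g \<omega>)\<^sup>2)" "integrable M (\<lambda>\<omega>. (avg n f \<omega>)\<^sup>2)"
      using fb gb
      by (intro integrable_unit; simp add: power_le_one)+
    have "v n \<le> expectation (\<lambda>\<omega>. (avg n g \<omega>)\<^sup>2 + 2 * e)"
      unfolding v_def by (intro integral_mono pt i Bochner_Integration.integrable_add integrable_const)
    also have "\<dots> = expectation (\<lambda>\<omega>. (avg n g \<omega>)\<^sup>2) + 2 * e"
      using i by (simp add: prob_space)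
    also have "expectation (\<lambda>\<omega>. (avg n g \<omega>)\<^sup>2) \<le> expectation (\<lambda>\<omega>. (g \<omega>)\<^sup>2)"
      by (rule expectation_avg_square_le[OF g])
    finally show ?thesis by simp
  qed
  \<comment> \<open>The mean of two averages is not itself a box average, but averaging it over a
    huge box of radius \<open>k\<close> almost gives \<open>avg k f\<close>, whose second moment is
    at least \<open>c\<close>. The error vanishes as \<open>k\<close> grows.\<close>
  have c_mean: "c \<le> expectation (\<lambda>\<omega>. ((avg n f \<omega> + avg m f \<omega>) / 2)\<^sup>2)" for n m
  proof -
    let ?g = "\<lambda>\<omega>. (avg n f \<omega> + avg m f \<omega>) / 2"
    have "c \<le> expectation (\<lambda>\<omega>. (?g \<omega>)\<^sup>2) + 2 * (box_excess l k n + box_excess l k m)" for k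
    proof (rule order_trans[OF c_le[of k] v_le])
      show "0 \<le> ?g \<omega> \<and> ?g \<omega> \<le> 1" if "\<omega> \<in> space M" for \<omega>
        using fb[OF that, of n] fb[OF that, of m] by auto
      show "\<bar>avg k ?g \<omega> - avg k f \<omega>\<bar> \<le> box_excess l k n + box_excess l k m"
        if "\<omega> \<in> space M" for \<omega>
        using close[OF that, of k n] close[OF that, of k m]
        unfolding avg_mean abs_le_iff by (auto simp: field_simps)
    qed measurable
    moreover have "(\<lambda>k. expectation (\<lambda>\<omega>. (?g \<omega>)\<^sup>2) + 2 * (box_excess l k n + box_excess l k m))
        \<longlonglongrightarrow> expectation (\<lambda>\<omega>. (?g \<omega>)\<^sup>2) + 2 * (0 + 0)"
      by (intro tendsto_intros box_excess_tendsto)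
    ultimately show ?thesis
      using LIMSEQ_le_const by (metis (no_types, lifting) add.right_neutral mult_zero_right)
  qed
  \<comment> \<open>The constants fit:
    \<open>\<delta> / 8 + 2 * \<delta> / 16 = \<delta> / 4\<close>, and the parallelogram identity
    turns \<open>v n, v m < c + \<delta> / 4\<close> into the bound
    \<open>4 * (c + \<delta> / 4) - 4 * c = \<delta>\<close>.\<close>
  have "\<exists>m. v m < c + \<delta> / 8"
    using cInf_lessD[of "range v" "c + \<delta> / 8"] \<delta> by (auto simp: c_def)
  then obtain m0 where m0: "v m0 < c + \<delta> / 8" ..
  have "\<forall>\<^sub>F n in sequentially. box_excess l n m0 < \<delta> / 16"
    by (rule order_tendstoD(2)[OF box_excess_tendsto]) (use \<delta> in simp)
  then obtain N where N: "\<And>n. n \<ge> N \<Longrightarrow> box_excess l n m0 < \<delta> / 16"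
    by (auto simp: eventually_sequentially)
  have v_small: "v n < c + \<delta> / 4" if "n \<ge> N" for n
  proof -
    have "v n \<le> v m0 + 2 * box_excess l n m0"
      unfolding v_def using v_le[of "avg m0 f" n "box_excess l n m0"] fb close by (simp add: v_def)
    with m0 N[OF that] show ?thesis by simp
  qed
  have "expectation (\<lambda>\<omega>. (avg n f \<omega> - avg m f \<omega>)\<^sup>2) < \<delta>" if "n \<ge> N" "m \<ge> N" for n m
  proof -
    have i: "integrable M (\<lambda>\<omega>. (avg n f \<omega>)\<^sup>2)" for n
      using fb by (intro integrable_unit) (simp_all add: power_le_one)
    have im: "integrable M (\<lambda>\<omega>. ((avg n f \<omega> + avg m f \<omega>) / 2)\<^sup>2)"
    proof (rule integrable_unit)
      show "0 \<le> ((avg n f \<omega> + avg m f \<omega>) / 2)\<^sup>2 \<and> ((avg n f \<omega> + avg m f \<omega>) / 2)\<^sup>2 \<le> 1"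
        if "\<omega> \<in> space M" for \<omega>
        using fb[OF that, of n] fb[OF that, of m]
        by (auto intro!: power_le_one)
    qed measurable
    have "expectation (\<lambda>\<omega>. (avg n f \<omega> - avg m f \<omega>)\<^sup>2)
        = expectation (\<lambda>\<omega>. 2 * (avg n f \<omega>)\<^sup>2 + 2 * (avg m f \<omega>)\<^sup>2 - 4 * ((avg n f \<omega> + avg m f \<omega>) / 2)\<^sup>2)"
      by (intro Bochner_Integration.integral_cong refl) (simp add: power2_eq_square field_simps)
    also have "\<dots> = 2 * v n + 2 * v m - 4 * expectation (\<lambda>\<omega>. ((avg n f \<omega> + avg m f \<omega>) / 2)\<^sup>2)"
      unfolding v_def using i im
      by (subst Bochner_Integration.integral_diff Bochner_Integration.integral_add; simp)+
    also have "\<dots> < \<delta>"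
      using v_small[OF that(1)] v_small[OF that(2)] c_mean[of n m] by simp
    finally show ?thesis .
  qed
  then show ?thesis by blast
qed

section \<open>Almost sure convergence of box averages\<close>

lemma avg_AE_convergent_subseq:
  assumes f: "f \<in> borel_measurable M" "\<And>\<omega>. \<omega> \<in> space M \<Longrightarrow> 0 \<le> f \<omega> \<and> f \<omega> \<le> 1"
  shows "\<exists>s. strict_mono s \<and> (AE \<omega> in M. convergent (\<lambda>j. avg (s j) f \<omega>))"
proof -
  have [measurable]: "f \<in> borel_measurable M" "avg n f \<in> borel_measurable M" for n
    using f(1) avg_measurable by auto
  have fb: "0 \<le> avg n f \<omega> \<and> avg n f \<omega> \<le> 1" if "\<omega> \<in> space M" for n \<omega>
    using f(2) that by (rule avg_bounds)
  have "\<exists>N. \<forall>j. \<forall>n\<ge>N j. \<forall>m\<ge>N j. expectation (\<lambda>\<omega>. (avg n f \<omega> - avg m f \<omega>)\<^sup>2) < (1 / 4) ^ j"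
    using avg_L2_Cauchy[OF f] by (intro choice) auto
  then obtain N :: "nat \<Rightarrow> nat" where
    N: "\<And>j n m. n \<ge> N j \<Longrightarrow> m \<ge> N j \<Longrightarrow> expectation (\<lambda>\<omega>. (avg n f \<omega> - avg m f \<omega>)\<^sup>2) < (1 / 4) ^ j"
    by metis
  \<comment> \<open>Partial sums of \<open>Suc (N i)\<close> are strictly increasing and dominate
    every \<open>N j\<close>.\<close>
  define s where "s = (\<lambda>j. \<Sum>i\<le>j. Suc (N i))"
  have s: "strict_mono s" unfolding s_def strict_mono_Suc_iff by simp
  have "N j \<le> s j" for j
    unfolding s_def using member_le_sum[of j "{..j}" "\<lambda>i. Suc (N i)"] by simp
  moreover have "s j \<le> s (Suc j)" for j using s by (simp add: strict_mono_less_eq)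
  ultimately have Ns: "N j \<le> s j" "N j \<le> s (Suc j)" for j using order_trans by blast+
  define D where "D = (\<lambda>j \<omega>. \<bar>avg (s (Suc j)) f \<omega> - avg (s j) f \<omega>\<bar>)"
  have [measurable]: "D j \<in> borel_measurable M" for j unfolding D_def by measurable
  have Db: "0 \<le> D j \<omega> \<and> D j \<omega> \<le> 1" if "\<omega> \<in> space M" for j \<omega>
    using fb[OF that, of "s j"] fb[OF that, of "s (Suc j)"]
    unfolding D_def by auto
  have iD: "integrable M (D j)" "integrable M (\<lambda>\<omega>. (D j \<omega>)\<^sup>2)" for j
    using Db[of _ j] by (intro integrable_unit; simp add: power_le_one)+
  have ED: "expectation (D j) \<le> 2 * (1 / 2) ^ j" for j
  proof -
    \<comment> \<open>A weighted arithmetic-geometric mean inequality in place of Cauchy-Schwarz: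
      with weight \<open>2 ^ j\<close> the L2 bound \<open>(1 / 4) ^ j\<close> becomes a summable L1
      bound.\<close>
    have pt: "D j \<omega> \<le> (1 / 2) ^ j + 2 ^ j * (D j \<omega>)\<^sup>2" for \<omega>
    proof -
      have "0 \<le> (2 ^ j * D j \<omega> - 1)\<^sup>2" by simp
      also have "\<dots> = 2 ^ j * (2 ^ j * (D j \<omega>)\<^sup>2 - 2 * D j \<omega> + (1 / 2) ^ j)"
        by (simp add: power2_eq_square field_simps)
      finally have "2 ^ j * (D j \<omega>)\<^sup>2 - 2 * D j \<omega> + (1 / 2) ^ j \<ge> 0"
        by (auto simp: zero_le_mult_iff power_le_zero_eq)
      moreover have "D j \<omega> \<ge> 0" by (simp add: D_def)
      ultimately show ?thesis by linarith
    qed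
    have "expectation (D j) \<le> expectation (\<lambda>\<omega>. (1 / 2) ^ j + 2 ^ j * (D j \<omega>)\<^sup>2)"
      by (intro integral_mono pt iD Bochner_Integration.integrable_add integrable_const integrable_mult_right)
    also have "\<dots> = (1 / 2) ^ j + 2 ^ j * expectation (\<lambda>\<omega>. (D j \<omega>)\<^sup>2)"
      using iD by (simp add: prob_space)
    also have "\<dots> \<le> (1 / 2) ^ j + 2 ^ j * (1 / 4) ^ j"
      using N[OF Ns(2) Ns(1), of j] by (simp add: D_def less_imp_le)
    also have "(2::real) ^ j * (1 / 4) ^ j = (1 / 2) ^ j"
      by (simp add: power_mult_distrib[symmetric])
    finally show ?thesis by simp
  qed
  \<comment> \<open>By Tonelli the total variation along the subsequence has finite expectation, so
    almost surely the increments are absolutely summable and telescope to a limit.\<close>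
  have "(\<integral>\<^sup>+\<omega>. (\<Sum>j. ennreal (D j \<omega>)) \<partial>M) = (\<Sum>j. \<integral>\<^sup>+\<omega>. ennreal (D j \<omega>) \<partial>M)"
    by (rule nn_integral_suminf) measurable
  also have "\<dots> = (\<Sum>j. ennreal (expectation (D j)))"
    using iD Db by (intro suminf_cong nn_integral_eq_integral) auto
  also have "\<dots> \<le> (\<Sum>j. ennreal (2 * (1 / 2) ^ j))"
    by (intro suminf_le summableI ennreal_leI ED)
  also have "\<dots> = ennreal (\<Sum>j. 2 * (1 / 2) ^ j)"
    by (intro suminf_ennreal2 summable_mult summable_geometric) auto
  finally have "(\<integral>\<^sup>+\<omega>. (\<Sum>j. ennreal (D j \<omega>)) \<partial>M) \<noteq> \<infinity>"
    by (auto simp: top_unique)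
  then have "AE \<omega> in M. (\<Sum>j. ennreal (D j \<omega>)) \<noteq> \<infinity>"
    by (intro nn_integral_PInf_AE) measurable
  then have "AE \<omega> in M. convergent (\<lambda>j. avg (s j) f \<omega>)"
  proof eventually_elim
    case (elim \<omega>)
    then have "summable (\<lambda>j. D j \<omega>)"
      by (intro summable_suminf_not_top) (auto simp: D_def)
    then have "summable (\<lambda>j. avg (s (Suc j)) f \<omega> - avg (s j) f \<omega>)"
      unfolding D_def by (rule summable_rabs_cancel)
    then have "(\<lambda>n. (\<Sum>j<n. avg (s (Suc j)) f \<omega> - avg (s j) f \<omega>) + avg (s 0) f \<omega>)
        \<longlonglongrightarrow> (\<Sum>j. avg (s (Suc j)) f \<omega> - avg (s j) f \<omega>) + avg (s 0) f \<omega>"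
      by (intro tendsto_intros summable_LIMSEQ)
    then show ?case
      unfolding sum_lessThan_telescope[of "\<lambda>j. avg (s j) f \<omega>"] by (auto simp: convergent_def)
  qed
  with s show ?thesis by blast
qed

text \<open>The subsequence is found only inside the proof, so constancy is required along all of
  them; a limsup exists at every point. Once the limit is known to be constant,
  \<open>avg n f\<close> is compared with \<open>avg n (avg (s j) f)\<close>, whose distance to the
  constant is dominated, uniformly in \<open>n\<close>, by the maximal function of a variable with
  small expectation.\<close>

theorem ergodic_theorem:
  assumes f: "f \<in> borel_measurable M" "\<And>\<omega>. \<omega> \<in> space M \<Longrightarrow> 0 \<le> f \<omega> \<and> f \<omega> \<le> 1"
    and ergodic: "\<And>s. strict_mono s \<Longrightarrow> \<exists>c. AE \<omega> in M. limsup (\<lambda>j. ereal (avg (s j) f \<omega>)) = c"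
  shows "AE \<omega> in M. (\<lambda>n. avg n f \<omega>) \<longlonglongrightarrow> expectation f"
proof -
  let ?K = "2 ^ (CARD('n) - 1) :: real"
  have [measurable]: "f \<in> borel_measurable M" "avg n f \<in> borel_measurable M" for n
    using f(1) avg_measurable by auto
  have fb: "0 \<le> avg n f \<omega> \<and> avg n f \<omega> \<le> 1" if "\<omega> \<in> space M" for n \<omega>
    using f(2) that by (rule avg_bounds)
  have close: "\<bar>avg n (avg m f) \<omega> - avg n f \<omega>\<bar> \<le> box_excess l n m" if "\<omega> \<in> space M" for n m \<omega>
    using that f(2) by (rule avg_avg_diff_le)
  obtain s where s: "strict_mono s" "AE \<omega> in M. convergent (\<lambda>j. avg (s j) f \<omega>)"
    using avg_AE_convergent_subseq[OF f] by blast
  obtain c where c: "AE \<omega> in M. limsup (\<lambda>j. ereal (avg (s j) f \<omega>)) = c"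
    using ergodic[OF s(1)] by blast
  define m where "m = real_of_ereal c"
  have lim: "AE \<omega> in M. (\<lambda>j. avg (s j) f \<omega>) \<longlonglongrightarrow> m"
    using s(2) c
  proof eventually_elim
    case (elim \<omega>)
    then obtain x where x: "(\<lambda>j. avg (s j) f \<omega>) \<longlonglongrightarrow> x" by (auto simp: convergent_def)
    then have "limsup (\<lambda>j. ereal (avg (s j) f \<omega>)) = ereal x"
      by (intro lim_imp_Limsup) auto
    with elim x show ?case by (auto simp: m_def)
  qed
  have f_int: "integrable M f" by (rule integrable_unit[OF f])
  have bnd: "AE \<omega> in M. norm (avg n f \<omega>) \<le> 1" for n
    using fb by (intro AE_I2) auto
  \<comment> \<open>Averages preserve the expectation, and boundedness allows passing to the limit;
    this identifies the constant.\<close>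
  have "(\<lambda>j. expectation (avg (s j) f)) \<longlonglongrightarrow> expectation (\<lambda>_. m)"
    by (rule integral_dominated_convergence[where w = "\<lambda>_. 1"]) (use lim bnd in auto)
  then have m: "m = expectation f"
    by (simp add: expectation_avg[OF f_int] prob_space LIMSEQ_const_iff)
  define h where "h = (\<lambda>j \<omega>. \<bar>avg (s j) f \<omega> - m\<bar>)"
  have [measurable]: "h j \<in> borel_measurable M" for j unfolding h_def by measurable
  have m_bounds: "0 \<le> m" "m \<le> 1"
  proof -
    show "0 \<le> m" unfolding m using f(2) by (intro integral_nonneg_AE AE_I2) auto
    have "expectation f \<le> expectation (\<lambda>_. 1)"
      using f(2) by (intro integral_mono f_int) auto
    then show "m \<le> 1" by (simp add: m prob_space)
  qed
  have h_bounds: "0 \<le> h j \<omega> \<and> h j \<omega> \<le> 1" if "\<omega> \<in> space M" for j \<omega>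
    using fb[OF that, of "s j"] m_bounds unfolding h_def by auto
  have h_int: "integrable M (h j)" for j using h_bounds by (intro integrable_unit) auto
  have "(\<lambda>j. expectation (h j)) \<longlonglongrightarrow> expectation (\<lambda>_. 0)"
  proof (rule integral_dominated_convergence[where w = "\<lambda>_. 1"])
    show "AE \<omega> in M. (\<lambda>j. h j \<omega>) \<longlonglongrightarrow> 0"
      using lim unfolding h_def by eventually_elim (simp add: LIM_zero_iff tendsto_rabs_zero_iff)
    show "AE \<omega> in M. norm (h j \<omega>) \<le> 1" for j
      using h_bounds by (intro AE_I2) auto
  qed auto
  then have Eh: "(\<lambda>j. expectation (h j)) \<longlonglongrightarrow> 0" by simp
  have ev: "AE \<omega> in M. \<forall>\<^sub>F n in sequentially. \<bar>avg n f \<omega> - m\<bar> < 2 * \<epsilon>" if \<epsilon>: "\<epsilon> > 0" for \<epsilon> :: real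
  proof -
    \<comment> \<open>Off \<open>G j\<close> all averages of \<open>h j\<close> are at most
      \<open>\<epsilon>\<close>. The maximal inequality makes \<open>prob (G j)\<close> tend to 0,
      so almost every point avoids at least one of these events.\<close>
    define G where "G = (\<lambda>j. {\<omega>\<in>space M. \<exists>n. avg n (h j) \<omega> > \<epsilon>})"
    have [measurable]: "avg n (h j) \<in> borel_measurable M" for n j by (rule avg_measurable) measurable
    have Gm: "G j \<in> sets M" for j unfolding G_def by measurable
    have "prob (\<Inter>j. G j) \<le> ?K * expectation (h j) / \<epsilon>" for j
    proof -
      have "\<epsilon> * prob (G j) \<le> ?K * expectation (h j)"
        unfolding G_def using h_bounds by (intro maximal_inequality h_int \<epsilon>) auto
      moreover have "prob (\<Inter>j. G j) \<le> prob (G j)"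
        using Gm by (intro finite_measure_mono) auto
      ultimately show ?thesis
        using \<epsilon> by (simp add: field_simps) (meson mult_le_cancel_left_pos order_trans)
    qed
    moreover have "(\<lambda>j. ?K * expectation (h j) / \<epsilon>) \<longlonglongrightarrow> ?K * 0 / \<epsilon>"
      using \<epsilon> by (intro tendsto_intros Eh) auto
    ultimately have "prob (\<Inter>j. G j) \<le> ?K * 0 / \<epsilon>"
      by (intro LIMSEQ_le_const) auto
    then have "prob (\<Inter>j. G j) = 0"
      by (simp add: measure_le_0_iff)
    then have "AE \<omega> in M. \<omega> \<notin> (\<Inter>j. G j)"
      using Gm by (subst AE_iff_measurable[of "\<Inter>j. G j"]) (auto simp: emeasure_eq_measure G_def)
    then show ?thesis
    proof (rule AE_mp, intro AE_I2 impI)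
      fix \<omega> assume \<omega>: "\<omega> \<in> space M" "\<omega> \<notin> (\<Inter>j. G j)"
      then obtain j where j: "\<And>n. avg n (h j) \<omega> \<le> \<epsilon>"
        by (auto simp: G_def not_less)
      have "\<forall>\<^sub>F n in sequentially. box_excess l n (s j) < \<epsilon>"
        using order_tendstoD(2)[OF box_excess_tendsto \<epsilon>] .
      then show "\<forall>\<^sub>F n in sequentially. \<bar>avg n f \<omega> - m\<bar> < 2 * \<epsilon>"
      proof eventually_elim
        case (elim n)
        \<comment> \<open>One \<open>\<epsilon>\<close> pays for replacing \<open>f\<close> by
          \<open>avg (s j) f\<close>, the other comes from avoiding \<open>G j\<close>.\<close>
        have "avg n (avg (s j) f) \<omega> - m = avg n (\<lambda>\<omega>. avg (s j) f \<omega> - m) \<omega>"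
          by (simp add: avg_diff avg_const)
        then have "\<bar>avg n (avg (s j) f) \<omega> - m\<bar> \<le> avg n (h j) \<omega>"
          using avg_abs[of n "\<lambda>\<omega>. avg (s j) f \<omega> - m" \<omega>] by (simp add: h_def)
        with j[of n] elim close[OF \<omega>(1), of n "s j"] show ?case by linarith
      qed
    qed
  qed
  have "AE \<omega> in M. \<forall>i. \<forall>\<^sub>F n in sequentially. \<bar>avg n f \<omega> - m\<bar> < 2 * inverse (real (Suc i))"
    unfolding AE_all_countable by (intro allI ev) simp
  then show ?thesis
  proof eventually_elim
    case (elim \<omega>)
    show ?case
    proof (rule tendstoI)
      fix e :: real assume "e > 0"
      then obtain i where "inverse (real (Suc i)) < e / 2" using reals_Archimedean[of "e / 2"] by auto
      then show "\<forall>\<^sub>F n in sequentially. dist (avg n f \<omega>) (expectation f) < e"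
        using elim[rule_format, of i] by (auto simp: dist_real_def m elim!: eventually_mono)
    qed
  qed
qed

end

subsection \<open>Openings and the Fell topology\<close>

lemma closed_erosion:
  fixes B :: "'a::real_normed_vector set"
  assumes "closed B"
  shows "closed (erosion r B)"
proof -
  have "erosion r B = (\<Inter>u\<in>cball 0 r. (\<lambda>x. x + u) -` B)"
  proof (intro set_eqI iffI)
    fix x assume "x \<in> (\<Inter>u\<in>cball 0 r. (\<lambda>x. x + u) -` B)"
    then have "x + (y - x) \<in> B" if "norm (y - x) \<le> r" for y
      using that by (simp only: INT_iff vimage_eq mem_cball_0 simp_thms)
    then show "x \<in> erosion r B" by (auto simp: erosion_def dist_norm norm_minus_commute)
  qed (auto simp: erosion_def dist_norm)
  then show ?thesis
    using assms by (auto intro!: closed_INT closed_vimage continuous_intros)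
qed

lemma closed_set_opening:
  fixes B :: "'a::euclidean_space set"
  assumes "closed B"
  shows "closed (set_opening r B)"
proof -
  have "set_opening r B = (\<Union>x\<in>erosion r B. \<Union>y\<in>cball 0 r. {x + y})"
    by (auto simp: set_opening_def set_plus_def)
  then show ?thesis
    using closed_compact_sums[OF closed_erosion[OF assms] compact_cball] by simp
qed

text \<open>Lets the set itself be treated as the case of radius 0, so that measurability and
  convergence of its own volume need no separate proof.\<close>

lemma set_opening_0 [simp]: "set_opening 0 B = B"
  by (auto simp: set_opening_def erosion_def set_plus_def)

text \<open>Inside a ball of radius \<open>s\<close> that contains \<open>p = x + u\<close>, a ball
  of radius \<open>r\<close> can be slid towards \<open>p\<close>: the centre
  \<open>x + (1 - t) *\<^sub>R u\<close> with \<open>t = r / s\<close> keeps it inside the large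
  ball and leaves \<open>p\<close> at distance at most \<open>r\<close>.\<close>

lemma set_opening_antimono:
  fixes B :: "'a::real_normed_vector set"
  assumes "0 \<le> r" "r \<le> s"
  shows "set_opening s B \<subseteq> set_opening r B"
proof
  fix p assume "p \<in> set_opening s B"
  then obtain x u where p: "p = x + u" "cball x s \<subseteq> B" "norm u \<le> s"
    by (auto simp: set_opening_def erosion_def set_plus_def)
  show "p \<in> set_opening r B"
  proof (cases "s = 0")
    case True
    then have "r = s" using assms by simp
    with \<open>p \<in> set_opening s B\<close> show ?thesis by simp
  next
    case False
    with assms have s: "s > 0" by simp
    define t where "t = r / s"
    have t: "0 \<le> t" "t \<le> 1" "t * s = r" using assms s by (auto simp: t_def)
    have "norm ((1 - t) *\<^sub>R u) \<le> (1 - t) * s"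
      using t p(3) by (auto intro!: mult_left_mono)
    also have "\<dots> = s - r" using t by (simp add: algebra_simps)
    finally have n1: "norm ((1 - t) *\<^sub>R u) \<le> s - r" .
    have n2: "norm (t *\<^sub>R u) \<le> r"
      using t p(3) mult_left_mono[of "norm u" s t] by simp
    have "cball (x + (1 - t) *\<^sub>R u) r \<subseteq> cball x s"
    proof
      fix y assume "y \<in> cball (x + (1 - t) *\<^sub>R u) r"
      then show "y \<in> cball x s"
        using n1 norm_triangle_ineq[of "x + (1 - t) *\<^sub>R u - y" "- ((1 - t) *\<^sub>R u)"]
        by (simp add: dist_norm)
    qed
    then have "x + (1 - t) *\<^sub>R u \<in> erosion r B" using p(2) by (auto simp: erosion_def)
    moreover have "p = (x + (1 - t) *\<^sub>R u) + t *\<^sub>R u"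
      by (simp add: p(1) algebra_simps)
    ultimately show ?thesis
      using n2 by (auto simp: set_opening_def intro!: set_plus_intro)
  qed
qed

lemma set_opening_translation:
  fixes B :: "'a::real_normed_vector set"
  shows "set_opening r ((\<lambda>y. y - x) ` B) = (\<lambda>y. y - x) ` set_opening r B"
proof -
  have sub: "cball y r \<subseteq> (\<lambda>y. y - x) ` B \<longleftrightarrow> cball (y + x) r \<subseteq> B" for y
  proof -
    have 1: "A \<subseteq> (\<lambda>y. y - x) ` B \<longleftrightarrow> (\<lambda>y. y + x) ` A \<subseteq> B" for A
      by (force simp: image_iff)
    have "(\<lambda>z. z + x) ` cball y r = cball (y + x) r"
      by (metis add.commute cball_translation image_cong)
    then show ?thesis by (simp add: 1)
  qed
  have er: "y \<in> erosion r ((\<lambda>y. y - x) ` B) \<longleftrightarrow> y + x \<in> erosion r B" for y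
    by (simp add: erosion_def sub)
  show ?thesis
  proof (intro set_eqI iffI)
    fix p assume "p \<in> set_opening r ((\<lambda>y. y - x) ` B)"
    then obtain a u where "p = a + u" "a \<in> erosion r ((\<lambda>y. y - x) ` B)" "u \<in> cball 0 r"
      by (auto simp: set_opening_def elim!: set_plus_elim)
    then show "p \<in> (\<lambda>y. y - x) ` set_opening r B"
      by (intro image_eqI[of _ _ "(a + x) + u"]) (auto simp: er set_opening_def intro!: set_plus_intro)
  next
    fix p assume "p \<in> (\<lambda>y. y - x) ` set_opening r B"
    then obtain a u where "p = a + u - x" "a \<in> erosion r B" "u \<in> cball 0 r"
      by (auto simp: set_opening_def elim!: set_plus_elim)
    then have "p = (a - x) + u" "a - x \<in> erosion r ((\<lambda>y. y - x) ` B)" "u \<in> cball 0 r"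
      by (simp_all add: er)
    then show "p \<in> set_opening r ((\<lambda>y. y - x) ` B)"
      unfolding set_opening_def by (metis set_plus_intro)
  qed
qed

lemma openin_fell_miss: "compact K \<Longrightarrow> openin fell_topology {F. closed F \<and> F \<inter> K = {}}"
  unfolding fell_topology_def by (rule topology_generated_by_Basis) blast

text \<open>Opening is upper semicontinuous in the Fell topology. If \<open>cball a r\<close> is not contained in \<open>F\<close>
  for any \<open>a\<close> in a compact set, this is witnessed by finitely many small balls missed by \<open>F\<close>.\<close>

lemma openin_fell_opening_miss:
  fixes K :: "'a::euclidean_space set"
  assumes K: "compact K"
  shows "openin fell_topology {F. closed F \<and> set_opening r F \<inter> K = {}}"
proof (subst openin_subopen, intro ballI)
  fix F assume "F \<in> {F. closed F \<and> set_opening r F \<inter> K = {}}"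
  then have F: "closed F" "set_opening r F \<inter> K = {}" by auto
  \<comment> \<open>The centres of all balls of radius \<open>r\<close> that meet \<open>K\<close>.
    The opening misses \<open>K\<close> exactly when the erosion misses this compact set.\<close>
  define K' where "K' = {x + y |x y. x \<in> K \<and> y \<in> cball 0 r}"
  have K': "compact K'" unfolding K'_def by (intro compact_sums K compact_cball)
  have "\<exists>y e. y \<in> cball x r \<and> e > 0 \<and> cball y e \<inter> F = {}" if x: "x \<in> K'" for x
  proof -
    obtain k u where k: "x = k + u" "k \<in> K" "u \<in> cball 0 r" using x by (auto simp: K'_def)
    have "x \<notin> erosion r F"
    proof
      assume "x \<in> erosion r F"
      then have "x + - u \<in> set_opening r F"
        unfolding set_opening_def using k(3) by (intro set_plus_intro) auto
      with k F(2) show False by auto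
    qed
    then obtain y where y: "y \<in> cball x r" "y \<notin> F"
      unfolding erosion_def mem_Collect_eq by blast
    have "open (- F)" using F(1) by auto
    then obtain e where "e > 0" "cball y e \<subseteq> - F"
      using y(2) unfolding open_contains_cball by auto
    with y show ?thesis by blast
  qed
  then obtain y e where ye: "\<And>x. x \<in> K' \<Longrightarrow> y x \<in> cball x r" "\<And>x. x \<in> K' \<Longrightarrow> e x > 0"
    "\<And>x. x \<in> K' \<Longrightarrow> cball (y x) (e x) \<inter> F = {}" by metis
  have "K' \<subseteq> (\<Union>x\<in>K'. ball x (e x))" using ye(2) by force
  then obtain D where D: "D \<subseteq> K'" "finite D" "K' \<subseteq> (\<Union>x\<in>D. ball x (e x))"
    using compactE_image[OF K', of K' "\<lambda>x. ball x (e x)"] by auto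
  define C where "C = (\<Union>x\<in>D. cball (y x) (e x))"
  have "compact C" unfolding C_def using D(2) by (intro compact_UN) auto
  then have "openin fell_topology {F. closed F \<and> F \<inter> C = {}}" by (rule openin_fell_miss)
  moreover have "F \<in> {F. closed F \<and> F \<inter> C = {}}" using F(1) D(1) ye(3) by (auto simp: C_def)
  moreover have "set_opening r F' \<inter> K = {}" if F': "F' \<inter> C = {}" for F'
  proof (rule ccontr)
    assume "set_opening r F' \<inter> K \<noteq> {}"
    then obtain a u where a: "a + u \<in> K" "cball a r \<subseteq> F'" "u \<in> cball 0 r"
      by (auto simp: set_opening_def erosion_def elim!: set_plus_elim)
    have "a = (a + u) + - u" by simp
    then have "a \<in> K'" unfolding K'_def using a(1,3) by fastforce
    then obtain x where x: "x \<in> D" "dist x a < e x" using D(3) by auto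
    \<comment> \<open>The witness moves along with the centre: the new point lies relative to
      \<open>a\<close> as \<open>y x\<close> does relative to \<open>x\<close>, and it is displaced
      by less than \<open>e x\<close>.\<close>
    have "y x + (a - x) \<in> cball a r"
      using ye(1)[of x] x(1) D(1) by (auto simp: dist_norm algebra_simps)
    moreover have "y x + (a - x) \<in> C"
      unfolding C_def using x by (intro UN_I[of x]) (auto simp: dist_norm norm_minus_commute)
    ultimately show False using a(2) F' by auto
  qed
  ultimately show "\<exists>T. openin fell_topology T \<and> F \<in> T \<and> T \<subseteq> {F. closed F \<and> set_opening r F \<inter> K = {}}"
    by (intro exI[of _ "{F. closed F \<and> F \<inter> C = {}}"]) auto
qed

lemma sets_fell_borelI: "openin fell_topology U \<Longrightarrow> U \<in> sets fell_borel"
  unfolding fell_borel_def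
  using openin_subset[of fell_topology] by (subst sets_measure_of) (auto simp: topspace_fell_topology)

text \<open>The pairs \<open>(F, x)\<close> with \<open>x\<close> in the opening of \<open>F\<close>
  form a measurable set, and the measure of a section of such a set depends measurably on
  \<open>F\<close>. Measurability comes from writing the complement as a countable union of
  rectangles.\<close>

lemma measurable_volume_opening:
  fixes W :: "'a::euclidean_space set"
  assumes W: "W \<in> sets borel"
  shows "(\<lambda>F. measure lebesgue (set_opening r F \<inter> W)) \<in> borel_measurable fell_borel"
proof -
  obtain D :: "'a set" where D: "countable D" "\<And>X. open X \<Longrightarrow> X \<noteq> {} \<Longrightarrow> \<exists>d\<in>D. d \<in> X"
    using countable_dense_exists by blast
  define \<delta> where "\<delta> = (\<lambda>n::nat. inverse (real (Suc n)))"
  have \<delta>: "\<delta> n > 0" for n by (simp add: \<delta>_def)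
  \<comment> \<open>The closed ball is compact, which makes the first factor Fell-open; the smaller
    open ball collects the points certified to lie outside the opening.\<close>
  define R where "R = (\<lambda>(d::'a) n. {F. closed F \<and> set_opening r F \<inter> cball d (\<delta> n) = {}} \<times> ball d (\<delta> n))"
  define Q where "Q = ({F. closed F} \<times> UNIV - (\<Union>d\<in>D. \<Union>n. R d n)) \<inter> ({F. closed F} \<times> W)"
  have RM: "R d n \<in> sets (fell_borel \<Otimes>\<^sub>M lborel)" for d n
    unfolding R_def by (intro pair_measureI sets_fell_borelI openin_fell_opening_miss) auto
  have closedM: "{F. closed F} \<in> sets fell_borel"
    using sets.top[of fell_borel] by (simp add: space_fell_borel)
  have QM: "Q \<in> sets (fell_borel \<Otimes>\<^sub>M lborel)"
    unfolding Q_def using W D(1) RM closedM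
    by (intro sets.Int sets.Diff sets.countable_UN' sets.countable_UN pair_measureI) auto
  have slice: "Pair F -` Q = set_opening r F \<inter> W" if F: "closed F" for F
  proof -
    have "x \<in> set_opening r F \<longleftrightarrow> (F, x) \<notin> (\<Union>d\<in>D. \<Union>n. R d n)" for x
    proof
      assume "x \<in> set_opening r F"
      then show "(F, x) \<notin> (\<Union>d\<in>D. \<Union>n. R d n)" by (auto simp: R_def)
    next
      assume *: "(F, x) \<notin> (\<Union>d\<in>D. \<Union>n. R d n)"
      show "x \<in> set_opening r F"
      proof (rule ccontr)
        assume "x \<notin> set_opening r F"
        then obtain e where e: "e > 0" "ball x e \<subseteq> - set_opening r F"
          using closed_set_opening[OF F, of r] by (metis ComplI closed_def openE)
        \<comment> \<open>Points of the closed ball around \<open>d\<close> are within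
          \<open>2 * \<delta> n < e\<close> of \<open>x\<close>, hence the half.\<close>
        obtain n where n: "\<delta> n < e / 2"
          using reals_Archimedean[of "e / 2"] e(1) by (auto simp: \<delta>_def)
        obtain d where d: "d \<in> D" "dist x d < \<delta> n"
          using D(2)[of "ball x (\<delta> n)"] \<delta>[of n] by auto
        have "y \<in> ball x e" if "y \<in> cball d (\<delta> n)" for y
          using that d(2) n dist_triangle[of x y d] by auto
        then have "set_opening r F \<inter> cball d (\<delta> n) = {}" using e(2) by blast
        then have "(F, x) \<in> R d n" using F d(2) by (auto simp: R_def dist_commute)
        with * d(1) show False by blast
      qed
    qed
    then show ?thesis using F by (auto simp: Q_def)
  qed
  have "(\<lambda>F. emeasure lborel (Pair F -` Q)) \<in> borel_measurable fell_borel"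
    by (rule lborel.measurable_emeasure_Pair[OF QM])
  then have "(\<lambda>F. enn2real (emeasure lborel (Pair F -` Q))) \<in> borel_measurable fell_borel"
    by measurable
  also have "?this \<longleftrightarrow> ?thesis"
  proof (intro measurable_cong)
    fix F :: "'a set" assume "F \<in> space fell_borel"
    then have F: "closed F" by (simp add: space_fell_borel)
    have "set_opening r F \<inter> W \<in> sets borel"
      using closed_set_opening[OF F] W by (intro sets.Int) auto
    then show "enn2real (emeasure lborel (Pair F -` Q)) = measure lebesgue (set_opening r F \<inter> W)"
      by (simp add: slice[OF F] measure_completion measure_def[symmetric])
  qed
  finally show ?thesis .
qed

subsection \<open>Windows\<close>

lemma window_eq_cbox:
  "window l N = cbox (\<chi> i. if i = l then 0 else - (real N / 2)) (\<chi> i. if i = l then 1 else real N / 2)"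
  unfolding window_def mem_box_cart set_eq_iff by (auto split: if_splits)

lemma window_lmeasurable [simp]: "window l N \<in> lmeasurable"
  and window_borel [simp]: "window l N \<in> sets borel"
  by (simp_all add: window_eq_cbox)

lemma measure_window: "measure lebesgue (window (l::'n::finite) N) = real N ^ (CARD('n) - 1)"
proof -
  have "0 \<in> window l N" by (simp add: window_def)
  then have "measure lebesgue (window l N)
      = (\<Prod>i\<in>UNIV. (if i = l then 1 else real N / 2) - (if i = l then 0 else - (real N / 2)))"
    unfolding window_eq_cbox
    by (subst measure_completion, simp, subst content_cbox_cart) auto
  also have "\<dots> = (\<Prod>i\<in>UNIV. if i = l then 1 else real N)"
    by (intro prod.cong) auto
  also have "\<dots> = (\<Prod>i\<in>UNIV - {l}. real N)"
    by (subst prod.remove[of _ l]) (auto intro: prod.cong)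
  also have "\<dots> = real N ^ (CARD('n) - 1)"
    by (simp add: card_Diff_singleton)
  finally show ?thesis .
qed

lemma window_mono: "m \<le> n \<Longrightarrow> window l m \<subseteq> window l n"
  unfolding window_def by force

lemma closed_Int_window_lmeasurable: "closed X \<Longrightarrow> X \<inter> window l N \<in> lmeasurable"
  unfolding window_eq_cbox by (intro lmeasurable_compact closed_Int_compact compact_cbox)

lemma mem_translate_iff: "x \<in> (\<lambda>y. y + a) ` S \<longleftrightarrow> x - a \<in> S" for a :: "'a::ab_group_add"
  by (force simp: image_iff)

lemma measure_Int_translate:
  fixes A B :: "'a::euclidean_space set"
  shows "measure lebesgue ((\<lambda>y. y - x) ` A \<inter> B) = measure lebesgue (A \<inter> (\<lambda>y. y + x) ` B)"
proof -
  have "A \<inter> (\<lambda>y. y + x) ` B = (+) x ` ((\<lambda>y. y - x) ` A \<inter> B)"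
    by (force simp: image_iff add.commute)
  then show ?thesis by (simp add: measure_translation)
qed

lemma window_subset_translate:
  assumes "x $ l = 0" "\<And>i. \<bar>x $ i\<bar> \<le> real m"
  shows "(\<lambda>y. y + x) ` window l N \<subseteq> window l (N + 2 * m)"
proof
  fix y assume "y \<in> (\<lambda>y. y + x) ` window l N"
  then have y: "y - x \<in> window l N" by (simp add: mem_translate_iff)
  show "y \<in> window l (N + 2 * m)"
    unfolding window_def
  proof (intro CollectI conjI allI impI)
    fix i assume "i \<noteq> l"
    then show "- (real (N + 2 * m) / 2) \<le> y $ i" "y $ i \<le> real (N + 2 * m) / 2"
      using y assms(2)[of i] by (auto simp: window_def abs_le_iff field_simps dest!: spec[of _ i])
  qed (use y assms(1) in \<open>auto simp: window_def\<close>)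
qed

definition lattice_embed :: "int ^ 'n \<Rightarrow> real ^ 'n" where
  "lattice_embed z = (\<chi> i. real_of_int (z $ i))"

lemma lattice_embed_nth [simp]: "lattice_embed z $ i = real_of_int (z $ i)"
  by (simp add: lattice_embed_def)

lemma lattice_embed_add: "lattice_embed (z + w) = lattice_embed z + lattice_embed w"
  by (simp add: vec_eq_iff)

lemma mem_unit_window_translate:
  assumes "z $ l = 0"
  shows "x \<in> (\<lambda>y. y + lattice_embed z) ` window l 1 \<longleftrightarrow>
    (\<forall>i. i \<noteq> l \<longrightarrow> \<bar>x $ i - real_of_int (z $ i)\<bar> \<le> 1 / 2) \<and> 0 \<le> x $ l \<and> x $ l \<le> 1"
proof -
  have "- (1 / 2) \<le> a \<and> a \<le> 1 / 2 \<longleftrightarrow> \<bar>a\<bar> \<le> 1 / 2" for a :: real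
    by (auto simp: abs_if)
  then show ?thesis
    unfolding mem_translate_iff window_def using assms by simp
qed

text \<open>Unit cubes centred at integer points fill a centred window only if its side is odd,
  which explains the special role of odd \<open>N\<close>.\<close>

lemma window_odd_eq_Union:
  "window l (2 * n + 1) = (\<Union>z\<in>lattice_box l n. (\<lambda>y. y + lattice_embed z) ` window l 1)"
proof (intro set_eqI iffI)
  fix x assume x: "x \<in> window l (2 * n + 1)"
  \<comment> \<open>Rounding to the nearest integer, capped because on the face where a coordinate
    equals \<open>n + 1 / 2\<close> rounding up would give \<open>n + 1\<close>.\<close>
  define z :: "int ^ 'a" where "z = (\<chi> i. if i = l then 0 else min (int n) \<lfloor>x $ i + 1 / 2\<rfloor>)"
  have zi: "\<bar>z $ i\<bar> \<le> int n \<and> \<bar>x $ i - real_of_int (z $ i)\<bar> \<le> 1 / 2" if "i \<noteq> l" for i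
  proof -
    have b: "- real n \<le> x $ i + 1 / 2" "x $ i + 1 / 2 \<le> real n + 1"
      using x that by (auto simp: window_def field_simps)
    then have fl: "- int n \<le> \<lfloor>x $ i + 1 / 2\<rfloor>" by (simp add: le_floor_iff)
    show ?thesis
    proof (cases "int n \<le> \<lfloor>x $ i + 1 / 2\<rfloor>")
      case True
      then have "z $ i = int n" using that by (simp add: z_def min_def)
      moreover have "real n \<le> x $ i + 1 / 2" using True by (simp add: le_floor_iff)
      ultimately show ?thesis using b(2) by (auto simp: abs_if)
    next
      case False
      then have z: "z $ i = \<lfloor>x $ i + 1 / 2\<rfloor>" using that by (simp add: z_def)
      have "\<bar>x $ i - real_of_int \<lfloor>x $ i + 1 / 2\<rfloor>\<bar> \<le> 1 / 2" by linarith
      with fl False show ?thesis unfolding z by linarith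
    qed
  qed
  have "z $ l = 0" by (simp add: z_def)
  then have "z \<in> lattice_box l n" using zi by (simp add: lattice_box_def)
  moreover have "0 \<le> x $ l \<and> x $ l \<le> 1" using x by (simp add: window_def)
  then have "x \<in> (\<lambda>y. y + lattice_embed z) ` window l 1"
    using zi unfolding mem_unit_window_translate[OF \<open>z $ l = 0\<close>] by blast
  ultimately show "x \<in> (\<Union>z\<in>lattice_box l n. (\<lambda>y. y + lattice_embed z) ` window l 1)" by blast
next
  fix x assume "x \<in> (\<Union>z\<in>lattice_box l n. (\<lambda>y. y + lattice_embed z) ` window l 1)"
  then obtain z where z: "z \<in> lattice_box l n" "x \<in> (\<lambda>y. y + lattice_embed z) ` window l 1" by blast
  have "\<bar>lattice_embed z $ i\<bar> \<le> real n" for i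
  proof -
    have "\<bar>z $ i\<bar> \<le> int n" using z(1) by (cases "i = l") (auto simp: lattice_box_def)
    then show ?thesis by (metis lattice_embed_nth of_int_abs of_int_le_iff of_int_of_nat_eq)
  qed
  moreover have "lattice_embed z $ l = 0" using z(1) by (simp add: lattice_boxD)
  ultimately have "(\<lambda>y. y + lattice_embed z) ` window l 1 \<subseteq> window l (1 + 2 * n)"
    by (intro window_subset_translate)
  then show "x \<in> window l (2 * n + 1)"
    using z(2) by (auto simp: add.commute)
qed

lemma measure_Int_window_odd:
  assumes "closed X"
  shows "measure lebesgue (X \<inter> window l (2 * n + 1))
    = (\<Sum>z\<in>lattice_box l n. measure lebesgue (X \<inter> (\<lambda>y. y + lattice_embed z) ` window l 1))"
proof -
  have "X \<inter> window l (2 * n + 1)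
      = (\<Union>z\<in>lattice_box l n. X \<inter> (\<lambda>y. y + lattice_embed z) ` window l 1)"
    unfolding window_odd_eq_Union by blast
  also have "measure lebesgue \<dots>
      = (\<Sum>z\<in>lattice_box l n. measure lebesgue (X \<inter> (\<lambda>y. y + lattice_embed z) ` window l 1))"
  proof (rule measure_negligible_finite_Union_image)
    show "X \<inter> (\<lambda>y. y + lattice_embed z) ` window l 1 \<in> lmeasurable" for z
    proof (intro lmeasurable_compact closed_Int_compact assms)
      show "compact ((\<lambda>y. y + lattice_embed z) ` window l 1)"
        unfolding window_eq_cbox by (intro compact_continuous_image continuous_intros compact_cbox)
    qed
    show "pairwise (\<lambda>z w. negligible
        (X \<inter> (\<lambda>y. y + lattice_embed z) ` window l 1 \<inter> (X \<inter> (\<lambda>y. y + lattice_embed w) ` window l 1)))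
        (lattice_box l n)"
    proof (rule pairwiseI)
      fix z w assume zw: "z \<in> lattice_box l n" "w \<in> lattice_box l n" "z \<noteq> w"
      then have l0: "z $ l = 0" "w $ l = 0" by (auto dest: lattice_boxD)
      obtain i where i: "z $ i \<noteq> w $ i" using zw(3) by (auto simp: vec_eq_iff)
      with l0 have "i \<noteq> l" by auto
      \<comment> \<open>Distinct integers are at least 1 apart, so a point within one half of both
        is their midpoint. Two cubes therefore overlap only in a hyperplane.\<close>
      have "x $ i = (real_of_int (z $ i) + real_of_int (w $ i)) / 2"
        if "\<bar>x $ i - real_of_int (z $ i)\<bar> \<le> 1 / 2" "\<bar>x $ i - real_of_int (w $ i)\<bar> \<le> 1 / 2" for x :: "real ^ 'a"
      proof -
        have "real_of_int (z $ i) \<ge> real_of_int (w $ i) + 1 \<or> real_of_int (w $ i) \<ge> real_of_int (z $ i) + 1"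
          using i by linarith
        with that show ?thesis unfolding abs_le_iff by auto
      qed
      then have "X \<inter> (\<lambda>y. y + lattice_embed z) ` window l 1 \<inter> (X \<inter> (\<lambda>y. y + lattice_embed w) ` window l 1)
          \<subseteq> {x. x $ i = (real_of_int (z $ i) + real_of_int (w $ i)) / 2}"
        using \<open>i \<noteq> l\<close> unfolding subset_iff Int_iff mem_unit_window_translate[OF l0(1)]
          mem_unit_window_translate[OF l0(2)] by blast
      moreover have "negligible {x::real ^ 'a. x $ i = c}" for c
        using negligible_standard_hyperplane[of "axis i 1 :: real ^ 'a" c]
        by (simp add: inner_axis axis_in_Basis_iff)
      ultimately show "negligible
          (X \<inter> (\<lambda>y. y + lattice_embed z) ` window l 1 \<inter> (X \<inter> (\<lambda>y. y + lattice_embed w) ` window l 1))"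
        by (rule negligible_subset[rotated])
    qed
  qed simp
  finally show ?thesis .
qed

subsection \<open>Volumes of openings of a stationary random closed set\<close>

text \<open>A witness for the existential in \<open>stationary_ergodic\<close> is fixed once. All
  real shifts are kept, since ergodicity concerns events invariant under every one of them; the
  lattice action is derived by restriction.\<close>

locale stationary_random_set = prob_space M for M :: "'w measure" +
  fixes l :: "'n::finite" and \<Xi> :: "'w \<Rightarrow> (real ^ 'n) set" and T :: "real ^ 'n \<Rightarrow> 'w \<Rightarrow> 'w"
  assumes \<Xi>_measurable: "\<Xi> \<in> measurable M fell_borel"
    and T_group: "pres_group l M T"
    and covariant: "x $ l = 0 \<Longrightarrow> \<omega> \<in> space M \<Longrightarrow> \<Xi> (T x \<omega>) = (\<lambda>y. y - x) ` \<Xi> \<omega>"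
    and ergodic: "A \<in> sets (vimage_algebra (space M) \<Xi> fell_borel) \<Longrightarrow>
      (\<And>x. x $ l = 0 \<Longrightarrow> T x -` A \<inter> space M = A) \<Longrightarrow> measure M A \<in> {0, 1}"
begin

definition vol :: "real \<Rightarrow> nat \<Rightarrow> 'w \<Rightarrow> real" where
  "vol r N \<omega> = measure lebesgue (set_opening r (\<Xi> \<omega>) \<inter> window l N)"

lemma T_measurable: "x $ l = 0 \<Longrightarrow> T x \<in> measurable M M"
  and T_distr: "x $ l = 0 \<Longrightarrow> distr M M (T x) = M"
  and T_zero: "\<omega> \<in> space M \<Longrightarrow> T 0 \<omega> = \<omega>"
  and T_add: "x $ l = 0 \<Longrightarrow> y $ l = 0 \<Longrightarrow> \<omega> \<in> space M \<Longrightarrow> T (x + y) \<omega> = T x (T y \<omega>)"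
  using T_group by (auto simp: pres_group_def hyperplane_def)

lemma T_space: "x $ l = 0 \<Longrightarrow> \<omega> \<in> space M \<Longrightarrow> T x \<omega> \<in> space M"
  using measurable_space[OF T_measurable] .

lemma closed_\<Xi>: "\<omega> \<in> space M \<Longrightarrow> closed (\<Xi> \<omega>)"
  using measurable_space[OF \<Xi>_measurable] by (simp add: space_fell_borel)

sublocale lattice_action M l "\<lambda>z. T (lattice_embed z)"
  by unfold_locales (auto simp: T_measurable T_distr lattice_embed_add intro: T_add)

lemma vol_measurable [measurable]: "vol r N \<in> borel_measurable M"
  unfolding vol_def by (rule measurable_compose[OF \<Xi>_measurable measurable_volume_opening]) simp

lemma vol_lmeasurable: "\<omega> \<in> space M \<Longrightarrow> set_opening r (\<Xi> \<omega>) \<inter> window l N \<in> lmeasurable"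
  by (intro closed_Int_window_lmeasurable closed_set_opening closed_\<Xi>)

lemma vol_nonneg: "0 \<le> vol r N \<omega>"
  by (simp add: vol_def)

lemma vol_le: "\<omega> \<in> space M \<Longrightarrow> vol r N \<omega> \<le> real N ^ (CARD('n) - 1)"
  unfolding vol_def measure_window[of l N, symmetric]
  by (intro measure_mono_fmeasurable fmeasurableD vol_lmeasurable) auto

lemma vol_mono: "\<omega> \<in> space M \<Longrightarrow> m \<le> n \<Longrightarrow> vol r m \<omega> \<le> vol r n \<omega>"
  unfolding vol_def using window_mono[of m n l]
  by (intro measure_mono_fmeasurable fmeasurableD vol_lmeasurable) auto

lemma vol_antimono: "\<omega> \<in> space M \<Longrightarrow> 0 \<le> r \<Longrightarrow> r \<le> s \<Longrightarrow> vol s N \<omega> \<le> vol r N \<omega>"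
  unfolding vol_def using set_opening_antimono[of r s "\<Xi> \<omega>"]
  by (intro measure_mono_fmeasurable fmeasurableD vol_lmeasurable) auto

lemma vol_unit: "\<omega> \<in> space M \<Longrightarrow> 0 \<le> vol r 1 \<omega> \<and> vol r 1 \<omega> \<le> 1"
  using vol_nonneg[of r 1 \<omega>] vol_le[of \<omega> r 1] by simp

lemma volume_T:
  assumes "x $ l = 0" "\<omega> \<in> space M"
  shows "measure lebesgue (set_opening r (\<Xi> (T x \<omega>)) \<inter> W)
    = measure lebesgue (set_opening r (\<Xi> \<omega>) \<inter> (\<lambda>y. y + x) ` W)"
  by (simp only: covariant[OF assms] set_opening_translation measure_Int_translate)

text \<open>By covariance, shifting the set one way shifts the window the other way, so the orbit
  sum is a sum over translated unit cubes. The identity holds at every point of the space, as strict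
  invariance later requires.\<close>

lemma avg_vol:
  assumes "\<omega> \<in> space M"
  shows "avg n (vol r 1) \<omega> = vol r (2 * n + 1) \<omega> / real (2 * n + 1) ^ (CARD('n) - 1)"
proof -
  have "(\<Sum>z\<in>lattice_box l n. vol r 1 (T (lattice_embed z) \<omega>)) = vol r (2 * n + 1) \<omega>"
    unfolding vol_def measure_Int_window_odd[OF closed_set_opening[OF closed_\<Xi>[OF assms]]]
    by (intro sum.cong refl volume_T assms) (simp add: lattice_boxD)
  then show ?thesis by (simp add: avg_def card_lattice_box)
qed

lemma vol_T_le:
  assumes x: "x $ l = 0" "\<And>i. \<bar>x $ i\<bar> \<le> real m" and \<omega>: "\<omega> \<in> space M"
  shows "vol r N (T x \<omega>) \<le> vol r N \<omega> + (real (N + 2 * m) ^ (CARD('n) - 1) - real N ^ (CARD('n) - 1))"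
proof -
  let ?X = "set_opening r (\<Xi> \<omega>)"
  have X: "?X \<inter> window l k \<in> lmeasurable" for k by (rule vol_lmeasurable[OF \<omega>])
  have D: "window l (N + 2 * m) - window l N \<in> lmeasurable"
    by (intro fmeasurable_Diff fmeasurableD) auto
  have "?X \<inter> (\<lambda>y. y + x) ` window l N \<in> lmeasurable"
    unfolding window_eq_cbox
    by (intro lmeasurable_compact closed_Int_compact closed_set_opening closed_\<Xi> \<omega>
        compact_continuous_image continuous_intros compact_cbox)
  then have "vol r N (T x \<omega>) \<le> measure lebesgue (?X \<inter> window l N \<union> (window l (N + 2 * m) - window l N))"
    unfolding vol_def volume_T[OF x(1) \<omega>] using window_subset_translate[OF x, where N = N] X D
    by (intro measure_mono_fmeasurable fmeasurableD fmeasurable.Un) auto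
  also have "\<dots> \<le> vol r N \<omega> + measure lebesgue (window l (N + 2 * m) - window l N)"
    unfolding vol_def by (intro measure_Un_le fmeasurableD X D)
  also have "measure lebesgue (window l (N + 2 * m) - window l N)
      = measure lebesgue (window l (N + 2 * m)) - measure lebesgue (window l N)"
    by (intro measurable_measure_Diff window_mono fmeasurableD) auto
  finally show ?thesis by (simp add: measure_window)
qed

lemma avg_vol_T_le:
  assumes x: "x $ l = 0" "\<And>i. \<bar>x $ i\<bar> \<le> real m" and \<omega>: "\<omega> \<in> space M"
  shows "avg n (vol r 1) (T x \<omega>) \<le> avg n (vol r 1) \<omega> + box_excess l n m"
proof -
  let ?k = "CARD('n) - 1"
  have "vol r (2 * n + 1) (T x \<omega>) / real (2 * n + 1) ^ ?k
      \<le> (vol r (2 * n + 1) \<omega> + (real (2 * n + 1 + 2 * m) ^ ?k - real (2 * n + 1) ^ ?k)) / real (2 * n + 1) ^ ?k"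
    by (intro divide_right_mono vol_T_le x \<omega>) auto
  also have "\<dots> = vol r (2 * n + 1) \<omega> / real (2 * n + 1) ^ ?k
      + (real (2 * n + 1 + 2 * m) ^ ?k / real (2 * n + 1) ^ ?k - 1)"
    by (simp add: add_divide_distrib diff_divide_distrib)
  \<comment> \<open>The real shell has the same relative size as the lattice shell, because
    \<open>lattice_box l n\<close> has as many points as the window of side \<open>2 * n + 1\<close>
    has volume.\<close>
  also have "real (2 * n + 1 + 2 * m) ^ ?k / real (2 * n + 1) ^ ?k - 1 = box_excess l n m"
    unfolding box_excess_def card_lattice_box by (simp add: algebra_simps)
  finally show ?thesis using avg_vol[OF T_space[OF x(1) \<omega>]] avg_vol[OF \<omega>] by simp
qed

text \<open>A real shift changes each average by at most a boundary term that vanishes along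
  \<open>s\<close>. One inequality for all shifts suffices: the reverse one is the case of
  \<open>- x\<close> at the point \<open>T x \<omega>\<close>.\<close>

lemma limsup_avg_T:
  assumes x: "x $ l = 0" and \<omega>: "\<omega> \<in> space M" and s: "strict_mono s"
  shows "limsup (\<lambda>j. ereal (avg (s j) (vol r 1) (T x \<omega>))) = limsup (\<lambda>j. ereal (avg (s j) (vol r 1) \<omega>))"
proof -
  have le: "limsup (\<lambda>j. ereal (avg (s j) (vol r 1) (T x \<omega>))) \<le> limsup (\<lambda>j. ereal (avg (s j) (vol r 1) \<omega>))"
    if x: "x $ l = 0" and \<omega>: "\<omega> \<in> space M" for x \<omega>
  proof -
    obtain m where m: "norm x \<le> real m" using real_arch_simple by blast
    have m': "\<bar>x $ i\<bar> \<le> real m" for i using component_le_norm_cart[of x i] m by linarith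
    have "limsup (\<lambda>j. ereal (avg (s j) (vol r 1) (T x \<omega>)))
        \<le> limsup (\<lambda>j. ereal (box_excess l (s j) m) + ereal (avg (s j) (vol r 1) \<omega>))"
      using avg_vol_T_le[OF x m' \<omega>] by (intro Limsup_mono always_eventually allI) (simp add: add.commute)
    also have "\<dots> = 0 + limsup (\<lambda>j. ereal (avg (s j) (vol r 1) \<omega>))"
    proof (rule ereal_limsup_lim_add)
      have "(\<lambda>j. box_excess l (s j) m) \<longlonglongrightarrow> 0"
        using LIMSEQ_subseq_LIMSEQ[OF box_excess_tendsto s] by (simp add: o_def)
      then show "(\<lambda>j. ereal (box_excess l (s j) m)) \<longlonglongrightarrow> 0"
        by (simp add: zero_ereal_def)
    qed simp
    finally show ?thesis by simp
  qed
  have "T (- x) (T x \<omega>) = \<omega>"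
    using T_add[of "- x" x \<omega>] T_zero[OF \<omega>] x \<omega> by simp
  then show ?thesis
    using le[OF x \<omega>] le[of "- x" "T x \<omega>"] T_space[OF x \<omega>] x by simp
qed

text \<open>As \<open>G\<close> is a function of the closed set, its sublevel events belong to the
  sigma-algebra generated by \<open>\<Xi>\<close> and have probability 0 or 1; countably many
  rational levels then pin down the value.\<close>

lemma invariant_AE_const:
  fixes G :: "(real ^ 'n) set \<Rightarrow> ereal"
  assumes G: "G \<in> borel_measurable fell_borel"
    and inv: "\<And>x \<omega>. x $ l = 0 \<Longrightarrow> \<omega> \<in> space M \<Longrightarrow> G (\<Xi> (T x \<omega>)) = G (\<Xi> \<omega>)"
  shows "\<exists>c. AE \<omega> in M. G (\<Xi> \<omega>) = c"
proof -
  define A where "A = (\<lambda>q::rat. {\<omega>\<in>space M. G (\<Xi> \<omega>) \<le> ereal (real_of_rat q)})"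
  have GM [measurable]: "(\<lambda>\<omega>. G (\<Xi> \<omega>)) \<in> borel_measurable M"
    by (rule measurable_compose[OF \<Xi>_measurable G])
  have AM: "A q \<in> sets M" for q unfolding A_def by measurable
  have P: "prob (A q) \<in> {0, 1}" for q
  proof (rule ergodic)
    have "A q = \<Xi> -` {F \<in> space fell_borel. G F \<le> ereal (real_of_rat q)} \<inter> space M"
      using measurable_space[OF \<Xi>_measurable] by (auto simp: A_def)
    also have "\<dots> \<in> sets (vimage_algebra (space M) \<Xi> fell_borel)"
      by (intro in_vimage_algebra) (use G in measurable)
    finally show "A q \<in> sets (vimage_algebra (space M) \<Xi> fell_borel)" .
    show "T x -` A q \<inter> space M = A q" if "x $ l = 0" for x
      using that by (auto simp: A_def inv T_space)
  qed
  \<comment> \<open>The level at which the probability jumps from 0 to 1. As an extended real it is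
    also defined when no level, or every level, has probability 1.\<close>
  define c where "c = Inf ((\<lambda>q. ereal (real_of_rat q)) ` {q. prob (A q) = 1})"
  have ev: "AE \<omega> in M. (ereal (real_of_rat q) < c \<longrightarrow> \<not> G (\<Xi> \<omega>) \<le> ereal (real_of_rat q)) \<and>
      (c < ereal (real_of_rat q) \<longrightarrow> G (\<Xi> \<omega>) \<le> ereal (real_of_rat q))" for q
  proof -
    have lo: "AE \<omega> in M. \<not> G (\<Xi> \<omega>) \<le> ereal (real_of_rat q)" if q: "ereal (real_of_rat q) < c"
    proof -
      have "prob (A q) \<noteq> 1"
        using q INF_lower[of q "{q. prob (A q) = 1}" "\<lambda>q. ereal (real_of_rat q)"]
        by (auto simp: c_def)
      with P[of q] have "prob (A q) = 0" by auto
      then show ?thesis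
        using AM[of q] by (subst AE_iff_measurable[of "A q"]) (auto simp: A_def emeasure_eq_measure)
    qed
    have hi: "AE \<omega> in M. G (\<Xi> \<omega>) \<le> ereal (real_of_rat q)" if q: "c < ereal (real_of_rat q)"
    proof -
      obtain p where p: "prob (A p) = 1" "ereal (real_of_rat p) < ereal (real_of_rat q)"
        using q unfolding c_def Inf_less_iff by auto
      have "AE \<omega> in M. \<omega> \<in> A p" using p(1) AM[of p] by (simp add: prob_eq_1)
      then show ?thesis
        by eventually_elim (use p(2) in \<open>auto simp: A_def intro: order_trans less_imp_le\<close>)
    qed
    show ?thesis using lo hi by (cases "ereal (real_of_rat q)" c rule: linorder_cases) auto
  qed
  have "AE \<omega> in M. \<forall>q. (ereal (real_of_rat q) < c \<longrightarrow> \<not> G (\<Xi> \<omega>) \<le> ereal (real_of_rat q)) \<and>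
      (c < ereal (real_of_rat q) \<longrightarrow> G (\<Xi> \<omega>) \<le> ereal (real_of_rat q))"
    unfolding AE_all_countable using ev by blast
  then have "AE \<omega> in M. G (\<Xi> \<omega>) = c"
  proof eventually_elim
    case (elim \<omega>)
    show ?case
    proof (cases "G (\<Xi> \<omega>)" c rule: linorder_cases)
      case less
      then obtain q where "G (\<Xi> \<omega>) < ereal (real_of_rat q)" "ereal (real_of_rat q) < c"
        using ereal_dense3 by blast
      with elim show ?thesis by (meson less_imp_le)
    next
      case greater
      then obtain q where "c < ereal (real_of_rat q)" "ereal (real_of_rat q) < G (\<Xi> \<omega>)"
        using ereal_dense3 by blast
      with elim show ?thesis by (meson leD)
    qed
  qed
  then show ?thesis by blast
qed

lemma AE_avg_vol_tendsto: "AE \<omega> in M. (\<lambda>n. avg n (vol r 1) \<omega>) \<longlonglongrightarrow> expectation (vol r 1)"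
proof (rule ergodic_theorem)
  show "\<exists>c. AE \<omega> in M. limsup (\<lambda>j. ereal (avg (s j) (vol r 1) \<omega>)) = c" if s: "strict_mono s" for s
  proof -
    let ?k = "CARD('n) - 1"
    \<comment> \<open>The limsup rewritten as a functional of a closed set \<open>F\<close>, so that
      it visibly factors through \<open>\<Xi>\<close>.\<close>
    define G where "G = (\<lambda>F. limsup (\<lambda>j. ereal (measure lebesgue (set_opening r F \<inter> window l (2 * s j + 1))
      / real (2 * s j + 1) ^ ?k)))"
    have eq: "G (\<Xi> \<omega>) = limsup (\<lambda>j. ereal (avg (s j) (vol r 1) \<omega>))" if "\<omega> \<in> space M" for \<omega>
      unfolding G_def avg_vol[OF that] vol_def ..
    have "G \<in> borel_measurable fell_borel"
      unfolding G_def
      by (intro borel_measurable_limsup borel_measurable_ereal borel_measurable_divide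
          measurable_volume_opening borel_measurable_const) simp
    moreover have "G (\<Xi> (T x \<omega>)) = G (\<Xi> \<omega>)" if "x $ l = 0" "\<omega> \<in> space M" for x \<omega>
      using limsup_avg_T[OF that s] that by (simp add: eq T_space)
    ultimately obtain c where "AE \<omega> in M. G (\<Xi> \<omega>) = c" using invariant_AE_const by blast
    then have "AE \<omega> in M. limsup (\<lambda>j. ereal (avg (s j) (vol r 1) \<omega>)) = c"
      by (rule AE_mp) (auto intro!: AE_I2 simp: eq)
    then show ?thesis by blast
  qed
qed (use vol_unit in auto)

lemma AE_vol_tendsto:
  "AE \<omega> in M. (\<lambda>N. vol r N \<omega> / real N ^ (CARD('n) - 1)) \<longlonglongrightarrow> expectation (vol r 1)"
  using AE_avg_vol_tendsto[of r]
proof (rule AE_mp, intro AE_I2 impI)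
  let ?k = "CARD('n) - 1"
  fix \<omega> assume \<omega>: "\<omega> \<in> space M" and lim: "(\<lambda>n. avg n (vol r 1) \<omega>) \<longlonglongrightarrow> expectation (vol r 1)"
  \<comment> \<open>\<open>2 * n N + 1\<close> is the largest odd number up to
    \<open>N \<ge> 1\<close>, and the next odd number is at least \<open>N\<close>. Both are
    asymptotic to \<open>N\<close>, so the changed normalisation disappears in the limit.\<close>
  define n where "n = (\<lambda>N::nat. (N - 1) div 2)"
  have n: "filterlim n sequentially sequentially"
    unfolding filterlim_at_top
  proof
    show "\<forall>\<^sub>F N in sequentially. Z \<le> n N" for Z
      by (rule eventually_sequentiallyI[of "2 * Z + 1"]) (auto simp: n_def)
  qed
  have n1: "filterlim (\<lambda>N. Suc (n N)) sequentially sequentially"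
    by (rule filterlim_compose[OF filterlim_Suc n])
  have inv: "(\<lambda>N. 1 / real N) \<longlonglongrightarrow> 0" by (rule lim_1_over_n)
  have nb: "real (2 * n N + 1) \<le> real N" "real N \<le> real (2 * n N + 1) + 1" if "N \<ge> 1" for N
    using that by (auto simp: n_def)
  have lo: "(\<lambda>N. real (2 * n N + 1) / real N) \<longlonglongrightarrow> 1"
  proof (rule tendsto_sandwich)
    show "(\<lambda>N. 1 - 1 / real N) \<longlonglongrightarrow> 1" using tendsto_diff[OF tendsto_const inv, of 1] by simp
    show "\<forall>\<^sub>F N in sequentially. 1 - 1 / real N \<le> real (2 * n N + 1) / real N"
      using eventually_ge_at_top[of 1]
    proof eventually_elim
      case (elim N)
      then have "1 - 1 / real N = (real N - 1) / real N" by (simp add: diff_divide_distrib)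
      also have "\<dots> \<le> real (2 * n N + 1) / real N"
        using nb(2)[OF elim] by (intro divide_right_mono) auto
      finally show ?case .
    qed
    show "\<forall>\<^sub>F N in sequentially. real (2 * n N + 1) / real N \<le> 1"
      using eventually_ge_at_top[of 1] by eventually_elim (use nb in \<open>simp add: field_simps\<close>)
  qed auto
  have "(\<lambda>N. real (2 * n N + 1) / real N + 2 * (1 / real N)) \<longlonglongrightarrow> 1 + 2 * 0"
    by (intro tendsto_intros lo inv)
  then have hi: "(\<lambda>N. real (2 * Suc (n N) + 1) / real N) \<longlonglongrightarrow> 1"
    by (simp add: add_divide_distrib algebra_simps)
  show "(\<lambda>N. vol r N \<omega> / real N ^ ?k) \<longlonglongrightarrow> expectation (vol r 1)"
  proof (rule tendsto_sandwich)
    have "(\<lambda>N. (real (2 * n N + 1) / real N) ^ ?k * avg (n N) (vol r 1) \<omega>) \<longlonglongrightarrow> 1 ^ ?k * expectation (vol r 1)"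
      by (intro tendsto_intros lo filterlim_compose[OF lim n])
    then show "(\<lambda>N. (real (2 * n N + 1) / real N) ^ ?k * avg (n N) (vol r 1) \<omega>) \<longlonglongrightarrow> expectation (vol r 1)"
      by simp
    have "(\<lambda>N. (real (2 * Suc (n N) + 1) / real N) ^ ?k * avg (Suc (n N)) (vol r 1) \<omega>) \<longlonglongrightarrow> 1 ^ ?k * expectation (vol r 1)"
      by (intro tendsto_intros hi filterlim_compose[OF lim n1])
    then show "(\<lambda>N. (real (2 * Suc (n N) + 1) / real N) ^ ?k * avg (Suc (n N)) (vol r 1) \<omega>) \<longlonglongrightarrow> expectation (vol r 1)"
      by simp
    have cancel: "(real (2 * m + 1) / real N) ^ ?k * avg m (vol r 1) \<omega> = vol r (2 * m + 1) \<omega> / real N ^ ?k" for m N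
      unfolding avg_vol[OF \<omega>] by (simp add: power_divide)
    show "\<forall>\<^sub>F N in sequentially. (real (2 * n N + 1) / real N) ^ ?k * avg (n N) (vol r 1) \<omega> \<le> vol r N \<omega> / real N ^ ?k"
      unfolding cancel using eventually_ge_at_top[of 1]
      by eventually_elim (intro divide_right_mono vol_mono \<omega>, auto simp: n_def)
    show "\<forall>\<^sub>F N in sequentially. vol r N \<omega> / real N ^ ?k \<le> (real (2 * Suc (n N) + 1) / real N) ^ ?k * avg (Suc (n N)) (vol r 1) \<omega>"
      unfolding cancel using eventually_ge_at_top[of 1]
      by eventually_elim (intro divide_right_mono vol_mono \<omega>, auto simp: n_def)
  qed
qed

section \<open>From mean volumes to the critical radius\<close>

lemma expectation_volume_cbox:
  "(\<integral>\<omega>. measure lebesgue (set_opening r (\<Xi> \<omega>) \<inter> cbox 0 1) \<partial>M) = expectation (vol r 1)"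
proof -
  \<comment> \<open>Half a unit in all free coordinates: this shift lies in the hyperplane and
    carries the unit window onto the unit cube, so stationarity identifies the two mean
    volumes.\<close>
  define x :: "real ^ 'n" where "x = (\<chi> i. if i = l then 0 else 1 / 2)"
  have x: "x $ l = 0" by (simp add: x_def)
  have "(\<lambda>y. y + x) ` window l 1 = cbox 0 1"
  proof (intro set_eqI)
    fix y
    have "y \<in> (\<lambda>y. y + x) ` window l 1 \<longleftrightarrow> (\<forall>i. 0 \<le> y $ i \<and> y $ i \<le> 1)"
      unfolding mem_translate_iff window_def x_def by (auto split: if_splits)
    then show "y \<in> (\<lambda>y. y + x) ` window l 1 \<longleftrightarrow> y \<in> cbox 0 1" by (simp add: mem_box_cart)
  qed
  then have "measure lebesgue (set_opening r (\<Xi> \<omega>) \<inter> cbox 0 1) = vol r 1 (T x \<omega>)" if "\<omega> \<in> space M" for \<omega>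
    unfolding vol_def volume_T[OF x that] by simp
  then have "(\<integral>\<omega>. measure lebesgue (set_opening r (\<Xi> \<omega>) \<inter> cbox 0 1) \<partial>M) = (\<integral>\<omega>. vol r 1 (T x \<omega>) \<partial>M)"
    by (intro Bochner_Integration.integral_cong refl)
  also have "\<dots> = (\<integral>\<omega>. vol r 1 \<omega> \<partial>distr M M (T x))"
    by (rule integral_distr[symmetric]) (use T_measurable[OF x] in auto)
  finally show ?thesis by (simp add: T_distr[OF x])
qed

lemma expectation_vol_antimono:
  assumes "0 \<le> r" "r \<le> s"
  shows "expectation (vol s 1) \<le> expectation (vol r 1)"
  by (intro integral_mono integrable_unit vol_antimono assms) (use vol_unit in auto)

lemma rmax_eq:
  "rmax M \<Xi> = Sup (ennreal ` {r. 0 \<le> r \<and> expectation (vol 0 1) \<le> 2 * expectation (vol r 1)})"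
proof -
  have "(\<integral>\<omega>. measure lebesgue (\<Xi> \<omega> \<inter> cbox 0 1) \<partial>M) = expectation (vol 0 1)"
    using expectation_volume_cbox[of 0] by simp
  then show ?thesis
    unfolding rmax_def expectation_volume_cbox by (simp add: field_simps)
qed

lemma rmax_est_eq:
  "rmax_est l N (\<Xi> \<omega>) = Sup (ennreal ` {r. 0 \<le> r \<and> vol 0 N \<omega> \<le> 2 * vol r N \<omega>})"
  unfolding rmax_est_def vol_def set_opening_0 ..

text \<open>If the gap closed at \<open>q\<close>, monotonicity would force equality at both
  \<open>q\<close> and \<open>r\<close>, giving two positive solutions.\<close>

lemma half_volume_gap:
  assumes unique: "\<exists>\<^sub>\<le>\<^sub>1 r. r > 0 \<and> 2 * expectation (vol r 1) = expectation (vol 0 1)"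
    and "0 < q" "q < r" "expectation (vol 0 1) \<le> 2 * expectation (vol r 1)"
  shows "expectation (vol 0 1) < 2 * expectation (vol q 1)"
proof (rule ccontr)
  assume "\<not> ?thesis"
  with assms expectation_vol_antimono[of q r]
  have "2 * expectation (vol q 1) = expectation (vol 0 1)" "2 * expectation (vol r 1) = expectation (vol 0 1)"
    by auto
  then show False
    using Uniq_D[OF unique, of q r] assms by auto
qed

text \<open>A deterministic argument at one sample point. Strict inequality between the limits at a
  rational radius transfers to all large windows. Working with the order of [0,\<infinity>] includes
  an infinite critical radius, for which only lower bounds have content.\<close>

lemma rmax_est_tendsto:
  assumes unique: "\<exists>\<^sub>\<le>\<^sub>1 r. r > 0 \<and> 2 * expectation (vol r 1) = expectation (vol 0 1)"
    and \<omega>: "\<omega> \<in> space M"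
    and lim: "\<And>q. q \<in> \<rat> \<Longrightarrow> (\<lambda>N. vol q N \<omega> / real N ^ (CARD('n) - 1)) \<longlonglongrightarrow> expectation (vol q 1)"
  shows "(\<lambda>N. rmax_est l N (\<Xi> \<omega>)) \<longlonglongrightarrow> rmax M \<Xi>"
proof (rule order_tendstoI)
  let ?k = "CARD('n) - 1"
  fix a assume "a < rmax M \<Xi>"
  then obtain r where r: "0 \<le> r" "expectation (vol 0 1) \<le> 2 * expectation (vol r 1)" "a < ennreal r"
    unfolding rmax_eq less_Sup_iff by auto
  then obtain a' where a': "a = ennreal a'" "0 \<le> a'" by (cases a) auto
  with r have "a' < r" by (simp add: ennreal_less_iff)
  \<comment> \<open>Since \<open>0 \<le> a'\<close>, this radius is positive, as the uniqueness
    argument demands.\<close>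
  then obtain q where q: "q \<in> \<rat>" "a' < q" "q < r" using Rats_dense_in_real by blast
  have "expectation (vol 0 1) < 2 * expectation (vol q 1)"
    using half_volume_gap[OF unique] q a'(2) r by simp
  moreover have "(\<lambda>N. 2 * (vol q N \<omega> / real N ^ ?k) - vol 0 N \<omega> / real N ^ ?k)
      \<longlonglongrightarrow> 2 * expectation (vol q 1) - expectation (vol 0 1)"
    by (intro tendsto_intros lim q) auto
  ultimately have "\<forall>\<^sub>F N in sequentially. 0 < 2 * (vol q N \<omega> / real N ^ ?k) - vol 0 N \<omega> / real N ^ ?k"
    by (intro order_tendstoD(1)) auto
  then show "\<forall>\<^sub>F N in sequentially. a < rmax_est l N (\<Xi> \<omega>)"
    using eventually_gt_at_top[of 0]
  proof eventually_elim
    case (elim N)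
    then have "vol 0 N \<omega> \<le> 2 * vol q N \<omega>"
      by (simp add: diff_divide_distrib[symmetric] zero_less_divide_iff)
    then have "ennreal q \<le> rmax_est l N (\<Xi> \<omega>)"
      unfolding rmax_est_eq using q(2) a'(2) by (intro Sup_upper) auto
    moreover have "a < ennreal q" using q(2) a' by (simp add: ennreal_less_iff)
    ultimately show ?case by simp
  qed
next
  let ?k = "CARD('n) - 1"
  fix a assume a: "rmax M \<Xi> < a"
  \<comment> \<open>The intermediate value is finite even if \<open>a\<close> is infinite, so a
    rational radius fits between the critical radius and \<open>c\<close>.\<close>
  then obtain c where c: "rmax M \<Xi> < c" "c < a" using dense by blast
  then obtain c' where c': "c = ennreal c'" "0 \<le> c'" by (cases c) auto
  obtain b where b: "rmax M \<Xi> = ennreal b" "0 \<le> b" using c(1) by (cases "rmax M \<Xi>") auto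
  have "b < c'" using c(1) b c' by (simp add: ennreal_less_iff)
  then obtain q where q: "q \<in> \<rat>" "b < q" "q < c'" using Rats_dense_in_real by blast
  have "2 * expectation (vol q 1) < expectation (vol 0 1)"
  proof (rule ccontr)
    assume "\<not> ?thesis"
    then have "ennreal q \<le> rmax M \<Xi>"
      unfolding rmax_eq using q(2) b(2) by (intro Sup_upper) auto
    then show False using q(2) b by (simp add: ennreal_le_iff2)
  qed
  moreover have "(\<lambda>N. vol 0 N \<omega> / real N ^ ?k - 2 * (vol q N \<omega> / real N ^ ?k))
      \<longlonglongrightarrow> expectation (vol 0 1) - 2 * expectation (vol q 1)"
    by (intro tendsto_intros lim q) auto
  ultimately have "\<forall>\<^sub>F N in sequentially. 0 < vol 0 N \<omega> / real N ^ ?k - 2 * (vol q N \<omega> / real N ^ ?k)"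
    by (intro order_tendstoD(1)) auto
  then show "\<forall>\<^sub>F N in sequentially. rmax_est l N (\<Xi> \<omega>) < a"
    using eventually_gt_at_top[of 0]
  proof eventually_elim
    case (elim N)
    then have less: "2 * vol q N \<omega> < vol 0 N \<omega>"
      by (simp add: diff_divide_distrib[symmetric] zero_less_divide_iff)
    \<comment> \<open>One rejected radius rejects all larger ones, so the whole supremum is
      controlled by testing \<open>q\<close> alone.\<close>
    have "r \<le> q" if "0 \<le> r" "vol 0 N \<omega> \<le> 2 * vol r N \<omega>" for r
      using vol_antimono[OF \<omega>, of q r N] less that q(2) b(2) by linarith
    then have "rmax_est l N (\<Xi> \<omega>) \<le> ennreal q"
      unfolding rmax_est_eq by (intro Sup_least) (auto intro!: ennreal_leI)
    also have "\<dots> < c" using q b(2) c' by (simp add: ennreal_less_iff)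
    finally show ?case using c(2) by simp
  qed
qed

text \<open>Countability of the rational radii provides a single exceptional null set.\<close>

theorem AE_rmax_est_tendsto:
  assumes unique: "\<exists>\<^sub>\<le>\<^sub>1 r. r > 0 \<and> 2 * expectation (vol r 1) = expectation (vol 0 1)"
  shows "AE \<omega> in M. (\<lambda>N. rmax_est l N (\<Xi> \<omega>)) \<longlonglongrightarrow> rmax M \<Xi>"
proof -
  have "AE \<omega> in M. \<forall>q\<in>\<rat>. (\<lambda>N. vol q N \<omega> / real N ^ (CARD('n) - 1)) \<longlonglongrightarrow> expectation (vol q 1)"
    by (intro AE_ball_countable' AE_vol_tendsto countable_rat)
  then show ?thesis
    by (rule AE_mp) (use rmax_est_tendsto[OF unique] in \<open>auto intro!: AE_I2\<close>)
qed

end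

theorem theorem5:
  fixes l :: "'n::finite"
    and M :: "'w measure"
    and \<Xi> :: "'w \<Rightarrow> (real ^ 'n) set"
  assumes "CARD('n) \<ge> 2"
    and "prob_space M" and "complete_measure M"
    and "random_closed_set M \<Xi>"
    and "stationary_ergodic l M \<Xi>"
    and "\<exists>\<^sub>\<le>\<^sub>1 r0. r0 > 0 \<and>
           2 * (\<integral>\<omega>. measure lebesgue (set_opening r0 (\<Xi> \<omega>) \<inter> window l 1) \<partial>M)
             = (\<integral>\<omega>. measure lebesgue (\<Xi> \<omega> \<inter> window l 1) \<partial>M)"
  shows "AE \<omega> in M. (\<lambda>N. rmax_est l N (\<Xi> \<omega>)) \<longlonglongrightarrow> rmax M \<Xi>"
proof -
  obtain T where T: "pres_group l M T"
    "\<forall>x\<in>hyperplane l. \<forall>\<omega>\<in>space M. \<Xi> (T x \<omega>) = (\<lambda>y. y - x) ` \<Xi> \<omega>"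
    "\<forall>A\<in>sets (vimage_algebra (space M) \<Xi> fell_borel).
      (\<forall>x\<in>hyperplane l. T x -` A \<inter> space M = A) \<longrightarrow> measure M A \<in> {0, 1}"
    using assms(5) unfolding stationary_ergodic_def by (elim exE conjE) (rule that)
  interpret prob_space M by fact
  interpret stationary_random_set M l \<Xi> T
  proof unfold_locales
    show "\<Xi> \<in> measurable M fell_borel" using assms(4) by (simp add: random_closed_set_def)
    show "pres_group l M T" by (rule T(1))
    show "\<Xi> (T x \<omega>) = (\<lambda>y. y - x) ` \<Xi> \<omega>" if "x $ l = 0" "\<omega> \<in> space M" for x \<omega>
      using T(2) that by (simp add: hyperplane_def)
    show "measure M A \<in> {0, 1}" if "A \<in> sets (vimage_algebra (space M) \<Xi> fell_borel)"
      "\<And>x. x $ l = 0 \<Longrightarrow> T x -` A \<inter> space M = A" for A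
      by (rule T(3)[rule_format, OF that(1)]) (rule that(2), simp add: hyperplane_def)
  qed
  show ?thesis
    using AE_rmax_est_tendsto assms(6) unfolding vol_def[abs_def] set_opening_0 .
qed

end
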